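(* Let $f\in\mathbb{T}[x_0,\dots,x_n]$ be a homogeneous tropical monomial or binomial (i.e. a homogeneous polynomial with exactly one or exactly two terms with nonzero coefficients). Then the only tropically principal ideal over $f$ is the Macaulay tropical ideal $[f]$. Moreover $[f]$ is equal to the realizable ideal $\mathrm{trop}(\langle F\rangle)$ for any lift $F$ of $f$ to a non-archimedean field, i.e. for any field $\Bbbk$ with a non-archimedean norm $\nu:\Bbbk\to\mathbb{T}$ and any $F\in\Bbbk[x_0,\dots,x_n]$ with $\mathrm{trop}(F)=f$.
   Context: $\mathbb{T}=(\mathbb{R}_{\ge 0},\max,\times)$ is the tropical semifield (isomorphic to $(\mathbb{R}\cup\{\infty\},\min,+)$). A finite sum in $\mathbb{T}$ tropically vanishes if its value is unchanged by dropping any single term. Tropical linear spaces. For a finite set $E$, a valuated matroid of rank $r$ is a nonzero $p\in\mathbb{T}^{\binom{E}{r}}$ such that for all $A\in\binom{E}{r+1}$, $B\in\binom{E}{r-1}$ the sum $\sum_{i\in A\setminus B}p_{A\setminus\{i\}}p_{B\cup\{i\}}$ tropically vanishes. The tropical linear space $L_p\subset\mathbb{T}^E$ of rank $r$ is the $\mathbb{T}$-submodule spanned by the cocircuits $\beta_C=\sum_{i\notin C}p_{C\cup\{i\}}e_i$, $C\in\binom{E}{r-1}$. Tropical ideals. Let $\Delta^n_d$ be the set of degree $d$ monomials in $x_0,\dots,x_n$; the degree $d$ part of $\mathbb{T}[x_0,\dots,x_n]$ is identified with $\mathbb{T}^{\Delta^n_d}$. A homogeneous ideal $J$ is a tropical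 ideal if each $J_d$ is a tropical linear space. A tropical ideal is tropically principal over $f$ if it is minimal, under inclusion, among tropical ideals containing $f$. Macaulay tropical ideal. For $d\ge\deg(f)$ the Macaulay matrix $\mathcal{D}_d(f)$ has rows indexed by $\Delta^n_{d-\deg(f)}$, columns indexed by $\Delta^n_d$, and $(X,Y)$ entry the coefficient of $Y$ in $Xf$. Then $[f]_d$ is the tropical linear space $L_p$ where $p_B$, for $B\subset\Delta^n_d$ with $|B|=|\Delta^n_{d-\deg(f)}|$, is the tropical maximal minor $\max_\sigma\prod_X\mathcal{D}_d(f)_{X,\sigma(X)}$ over bijections $\sigma:\Delta^n_{d-\deg(f)}\to B$ (the stable sum of the rows). For $d<\deg(f)$, $[f]_d=0$; and $[f]=\bigoplus_d[f]_d$. Tropicalization. A non-archimedean norm $\nu:\Bbbk\to\mathbb{T}$ on a field satisfies $\nu^{-1}(0)=\{0\}$, $\nu(1)=\nu(-1)=1$, $\nu(ab)=\nu(a)\nu(b)$, $\nu(a+b)\le\max(\nu(a),\nu(b))$. For a polynomial $F$, $\mathrm{trop}(F)$ is obtained by applying $\nu$ to all coefficients; for a homogeneous ideal $I$, $\mathrm{trop}(I)$ is the graded $\mathbb{T}$-submodule with $\mathrm{trop}(I)_d$ spanned by $\{\mathrm{trop}(G):G\in I_d\}$. *)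

theory Defs
  imports Complex_Main "HOL-Library.Poly_Mapping" "HOL-Library.FuncSet"
begin

section \<open>The tropical semifield\<close>

typedef trop = "{x :: real. 0 \<le> x}"
  by (rule exI[of _ 0]) simp

setup_lifting type_definition_trop

instantiation trop :: comm_semiring_1
begin

lift_definition zero_trop :: trop is "0 :: real" by simp
lift_definition one_trop :: trop is "1 :: real" by simp
lift_definition plus_trop :: "trop \<Rightarrow> trop \<Rightarrow> trop" is "max :: real \<Rightarrow> real \<Rightarrow> real" by simp
lift_definition times_trop :: "trop \<Rightarrow> trop \<Rightarrow> trop" is "(*) :: real \<Rightarrow> real \<Rightarrow> real" by simp

instance
proof
  fix a b c :: trop
  show "a + b + c = a + (b + c)" by transfer (rule max.assoc)
  show "a + b = b + a" by transfer (rule max.commute)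
  show "0 + a = a" by transfer simp
  show "a * b * c = a * (b * c)" by transfer simp
  show "a * b = b * a" by transfer simp
  show "1 * a = a" by transfer simp
  show "0 * a = 0" by transfer simp
  show "a * 0 = 0" by transfer simp
  show "(a + b) * c = a * c + b * c" by transfer (simp add: max_mult_distrib_right)
  show "(0 :: trop) \<noteq> 1" by transfer simp
qed

end

instantiation trop :: linorder
begin

lift_definition less_eq_trop :: "trop \<Rightarrow> trop \<Rightarrow> bool" is "(\<le>) :: real \<Rightarrow> real \<Rightarrow> bool" .
lift_definition less_trop :: "trop \<Rightarrow> trop \<Rightarrow> bool" is "(<) :: real \<Rightarrow> real \<Rightarrow> bool" .

instance
  by standard (transfer; force)+

end

definition tropically_vanishes :: "('i \<Rightarrow> trop) \<Rightarrow> 'i set \<Rightarrow> bool"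
  where "tropically_vanishes a I \<longleftrightarrow> (\<forall>j\<in>I. sum a (I - {j}) = sum a I)"


section \<open>Tropical linear spaces\<close>

text \<open>
  An element of $T^E$ is a finitely supported function whose keys lie in the finite set \<open>E\<close>. A
  Pluecker vector of rank \<open>r\<close> is a function \<open>p\<close> on all sets, of which only the values at
  \<open>r\<close>-element subsets of \<open>E\<close> are ever used. Sets of \<open>r - 1\<close> elements are described by
  \<open>card C + 1 = r\<close>, so that there are none if \<open>r = 0\<close>.
\<close>

definition valuated_matroid :: "'a set \<Rightarrow> nat \<Rightarrow> ('a set \<Rightarrow> trop) \<Rightarrow> bool"
  where "valuated_matroid E r p \<longleftrightarrow>
    finite E \<and>
    (\<exists>B\<subseteq>E. card B = r \<and> p B \<noteq> 0) \<and>
    (\<forall>A B. A \<subseteq> E \<and> card A = r + 1 \<and> B \<subseteq> E \<and> card B + 1 = r \<longrightarrow>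
      tropically_vanishes (\<lambda>i. p (A - {i}) * p (insert i B)) (A - B))"

definition smult :: "trop \<Rightarrow> ('a \<Rightarrow>\<^sub>0 trop) \<Rightarrow> ('a \<Rightarrow>\<^sub>0 trop)"
  where "smult c v = Poly_Mapping.map (\<lambda>x. c * x) v"

definition trop_submodule :: "('a \<Rightarrow>\<^sub>0 trop) set \<Rightarrow> bool"
  where "trop_submodule M \<longleftrightarrow>
    0 \<in> M \<and> (\<forall>v\<in>M. \<forall>w\<in>M. v + w \<in> M) \<and> (\<forall>c. \<forall>v\<in>M. smult c v \<in> M)"

definition cocircuit :: "'a set \<Rightarrow> ('a set \<Rightarrow> trop) \<Rightarrow> 'a set \<Rightarrow> ('a \<Rightarrow>\<^sub>0 trop)"
  where "cocircuit E p C = (\<Sum>i\<in>E - C. Poly_Mapping.single i (p (insert i C)))"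

definition linear_space_of :: "'a set \<Rightarrow> nat \<Rightarrow> ('a set \<Rightarrow> trop) \<Rightarrow> ('a \<Rightarrow>\<^sub>0 trop) set"
  where "linear_space_of E r p =
    trop_submodule hull {cocircuit E p C | C. C \<subseteq> E \<and> card C + 1 = r}"

definition tropical_linear_space :: "'a set \<Rightarrow> ('a \<Rightarrow>\<^sub>0 trop) set \<Rightarrow> bool"
  where "tropical_linear_space E L \<longleftrightarrow>
    (\<exists>r p. valuated_matroid E r p \<and> L = linear_space_of E r p)"


section \<open>Graded polynomials\<close>

text \<open>
  The variables $x_0, \dots, x_n$ are indexed by a finite type \<open>'v\<close> with $n + 1$ elements. Monomials
  are exponent vectors, and multiplication of polynomials is the convolution product of
  \<^theory>\<open>HOL-Library.Poly_Mapping\<close>.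
\<close>

type_synonym 'v monomial = "'v \<Rightarrow>\<^sub>0 nat"
type_synonym ('v, 'a) polynomial = "'v monomial \<Rightarrow>\<^sub>0 'a"

definition mdegree :: "'v::finite monomial \<Rightarrow> nat"
  where "mdegree m = (\<Sum>i\<in>UNIV. Poly_Mapping.lookup m i)"

definition monomials :: "nat \<Rightarrow> 'v::finite monomial set"
  where "monomials d = {m. mdegree m = d}"

text \<open>The degree of the zero polynomial is set to \<open>0\<close>.\<close>

definition pdegree :: "('v::finite, 'a::zero) polynomial \<Rightarrow> nat"
  where "pdegree f = Max (insert 0 (mdegree ` Poly_Mapping.keys f))"

definition homogeneous_of :: "nat \<Rightarrow> ('v::finite, 'a::zero) polynomial \<Rightarrow> bool"
  where "homogeneous_of d f \<longleftrightarrow> Poly_Mapping.keys f \<subseteq> monomials d"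

definition homogeneous :: "('v::finite, 'a::zero) polynomial \<Rightarrow> bool"
  where "homogeneous f \<longleftrightarrow> (\<exists>d. homogeneous_of d f)"

definition hom_component ::
    "nat \<Rightarrow> ('v::finite, 'a::comm_monoid_add) polynomial \<Rightarrow> ('v, 'a) polynomial"
  where "hom_component d f =
    (\<Sum>m\<in>Poly_Mapping.keys f \<inter> monomials d. Poly_Mapping.single m (Poly_Mapping.lookup f m))"

definition graded_part ::
    "('v::finite, 'a::zero) polynomial set \<Rightarrow> nat \<Rightarrow> ('v, 'a) polynomial set"
  where "graded_part J d = {g \<in> J. homogeneous_of d g}"

text \<open>
  The internal direct sum of the \<open>M d\<close>, for submodules \<open>M d\<close> of the degree \<open>d\<close> part of the
  polynomial ring.
\<close>

definition graded_sum ::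
    "(nat \<Rightarrow> ('v::finite, 'a::comm_monoid_add) polynomial set) \<Rightarrow> ('v, 'a) polynomial set"
  where "graded_sum M = {g. \<forall>d. hom_component d g \<in> M d}"

definition is_ideal :: "'a::comm_semiring_1 set \<Rightarrow> bool"
  where "is_ideal J \<longleftrightarrow> 0 \<in> J \<and> (\<forall>a\<in>J. \<forall>b\<in>J. a + b \<in> J) \<and> (\<forall>c. \<forall>a\<in>J. c * a \<in> J)"

definition homogeneous_ideal :: "('v::finite, 'a::comm_semiring_1) polynomial set \<Rightarrow> bool"
  where "homogeneous_ideal J \<longleftrightarrow> is_ideal J \<and> (\<forall>g\<in>J. \<forall>d. hom_component d g \<in> J)"


section \<open>Tropical ideals\<close>

definition tropical_ideal :: "('v::finite, trop) polynomial set \<Rightarrow> bool"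
  where "tropical_ideal J \<longleftrightarrow>
    homogeneous_ideal J \<and> (\<forall>d. tropical_linear_space (monomials d) (graded_part J d))"

definition tropically_principal ::
    "('v::finite, trop) polynomial \<Rightarrow> ('v, trop) polynomial set \<Rightarrow> bool"
  where "tropically_principal f J \<longleftrightarrow>
    tropical_ideal J \<and> f \<in> J \<and> (\<forall>J'. tropical_ideal J' \<and> f \<in> J' \<and> J' \<subseteq> J \<longrightarrow> J' = J)"


section \<open>The Macaulay tropical ideal\<close>

definition macaulay_matrix ::
    "('v::finite, trop) polynomial \<Rightarrow> 'v monomial \<Rightarrow> 'v monomial \<Rightarrow> trop"
  where "macaulay_matrix f X Y = Poly_Mapping.lookup (Poly_Mapping.single X 1 * f) Y"

text \<open>
  The maximum over all bijections is a sum in the tropical semifield. Bijections from \<open>R\<close> to \<open>B\<close> are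
  taken to be \<open>undefined\<close> outside \<open>R\<close>, so that there are only finitely many.
\<close>

definition maximal_minor :: "('r \<Rightarrow> 'c \<Rightarrow> trop) \<Rightarrow> 'r set \<Rightarrow> 'c set \<Rightarrow> trop"
  where "maximal_minor D R B =
    (\<Sum>\<sigma>\<in>{\<sigma> \<in> R \<rightarrow>\<^sub>E B. bij_betw \<sigma> R B}. \<Prod>X\<in>R. D X (\<sigma> X))"

definition macaulay_part ::
    "('v::finite, trop) polynomial \<Rightarrow> nat \<Rightarrow> ('v, trop) polynomial set"
  where "macaulay_part f d =
    (if d < pdegree f then {0}
     else let R = monomials (d - pdegree f) in
       linear_space_of (monomials d) (card R) (maximal_minor (macaulay_matrix f) R))"

definition macaulay_ideal :: "('v::finite, trop) polynomial \<Rightarrow> ('v, trop) polynomial set"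
  where "macaulay_ideal f = graded_sum (macaulay_part f)"


section \<open>Tropicalization\<close>

definition nonarch_norm :: "('k::field \<Rightarrow> trop) \<Rightarrow> bool"
  where "nonarch_norm \<nu> \<longleftrightarrow>
    (\<forall>a. \<nu> a = 0 \<longleftrightarrow> a = 0) \<and> \<nu> 1 = 1 \<and> \<nu> (- 1) = 1 \<and>
    (\<forall>a b. \<nu> (a * b) = \<nu> a * \<nu> b) \<and>
    (\<forall>a b. \<nu> (a + b) \<le> max (\<nu> a) (\<nu> b))"

definition trop_poly :: "('k::field \<Rightarrow> trop) \<Rightarrow> ('v, 'k) polynomial \<Rightarrow> ('v, trop) polynomial"
  where "trop_poly \<nu> F = Poly_Mapping.map \<nu> F"

definition trop_ideal ::
    "('k::field \<Rightarrow> trop) \<Rightarrow> ('v::finite, 'k) polynomial set \<Rightarrow> ('v, trop) polynomial set"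
  where "trop_ideal \<nu> I =
    graded_sum (\<lambda>d. trop_submodule hull (trop_poly \<nu> ` graded_part I d))"

end

theory Submission
  imports Defs
begin

text \<open>
  Let \<open>f\<close> be a binomial \<open>a x^u + b x^v\<close>. Join the monomials \<open>w + u\<close> and \<open>w + v\<close> by an edge, for every
  \<open>w\<close>. Since addition is cancellative and \<open>u \<noteq> v\<close>, each degree becomes a disjoint union of paths.
  There is a multiplicative function \<open>\<phi>\<close> on monomials with \<open>a \<phi>(v) = b \<phi>(u)\<close>; in the coordinates
  rescaled by \<open>\<phi>\<close> both nonzero entries of each row of the Macaulay matrix agree. A maximal minor is
  therefore a constant times $\prod_{m \in B} \phi(m)$ if the edges can be matched with \<open>B\<close>, and
  \<open>0\<close> otherwise. A matching exists iff \<open>B\<close> misses exactly one vertex of each path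
  (\<open>matching_iff_partition_basis\<close>). So $[f]_d$ belongs to the matroid of a partition, and it is
  spanned by the pairs $\phi(i) e_i + \phi(j) e_j$ with \<open>i\<close> and \<open>j\<close> on the same path
  (\<open>linear_space_of_partition\<close>).

  These pairs are in every tropical ideal that contains \<open>f\<close>. Neighbours on a path come from
  multiples of \<open>f\<close>. For other pairs, the inner vertices of the path are eliminated one by one: in a
  tropical linear space,
  $\alpha e_i + \beta e_j$ and $\beta e_j + \gamma e_k$ yield $\alpha e_i + \gamma e_k$
  (\<open>tropical_linear_space_eliminate\<close>). Hence $[f]$ is the least tropical ideal that contains \<open>f\<close>,
  and a least element is the only minimal one.

  If \<open>F\<close> lifts \<open>f\<close>, the same elimination over the field gives elements of \<open>\<langle>F\<rangle>\<close> that
  tropicalize to multiples of the pairs. Conversely, let \<open>G = H F\<close> and measure norms of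
  coefficients relative to \<open>\<phi>\<close>. By the ultrametric inequality the norm at a vertex is at most that
  of one of its two edges; following the path on that side for as long as the edges do not get
  smaller leads to another vertex whose norm is at least as large (\<open>lift_dominates_vertex\<close>).
  Such a vector is a sum of multiples of pairs (\<open>in_hull_pairs\<close>).

  If \<open>f\<close> is a monomial, $[f]_d$ is the coordinate subspace of the multiples of \<open>f\<close>.
\<close>

section \<open>Arithmetic of the tropical semifield\<close>

abbreviation (input) "lookup \<equiv> Poly_Mapping.lookup"
abbreviation (input) "single \<equiv> Poly_Mapping.single"
abbreviation (input) "keys \<equiv> Poly_Mapping.keys"

lemma plus_trop_eq_max: "a + b = max a (b :: trop)"
  unfolding max_def by transfer (simp add: max_def)

instance trop :: canonically_ordered_monoid_add
proof
  fix a b :: trop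
  show "a \<le> b \<longleftrightarrow> (\<exists>c. b = a + c)"
    unfolding plus_trop_eq_max by (metis max.absorb2 max.cobounded1)
qed

instance trop :: semiring_no_zero_divisors
  by standard (transfer, simp)

instance trop :: semiring_1_no_zero_divisors ..

instance trop :: ordered_comm_semiring
  by standard (transfer, simp add: mult_left_mono)

lemma add_idem_trop [simp]: "a + a = (a :: trop)"
  by (simp add: plus_trop_eq_max)

lemma trop_inverse:
  fixes a :: trop
  assumes "a \<noteq> 0"
  obtains c where "c * a = 1" "c \<noteq> 0"
proof -
  have "\<exists>c. c * a = 1"
    using assms
  proof transfer
    fix x :: real
    assume "0 \<le> x" "x \<noteq> 0"
    then show "\<exists>c\<in>{x. 0 \<le> x}. c * x = 1"
      by (intro bexI[of _ "1 / x"]) auto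
  qed
  then show ?thesis
    using that by (metis mult_zero_left zero_neq_one)
qed

lemma mult_le_cancel_trop:
  fixes a b c :: trop
  assumes "c \<noteq> 0"
  shows "c * a \<le> c * b \<longleftrightarrow> a \<le> b"
proof (intro iffI)
  obtain d where d: "d * c = 1"
    using assms by (rule trop_inverse)
  assume "c * a \<le> c * b"
  then have "d * (c * a) \<le> d * (c * b)"
    by (rule mult_left_mono) simp
  with d show "a \<le> b"
    by (metis mult.assoc mult_1)
qed (simp add: mult_left_mono)

lemma mult_cancel_trop:
  fixes a b c :: trop
  assumes "c \<noteq> 0"
  shows "c * a = c * b \<longleftrightarrow> a = b"
  using mult_le_cancel_trop[OF assms] by (metis order.antisym order.refl)

lemma prod_trop_nonzero:
  fixes g :: "'i \<Rightarrow> trop"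
  assumes "\<And>i. i \<in> I \<Longrightarrow> g i \<noteq> 0"
  shows "prod g I \<noteq> 0"
  using assms by (induction I rule: infinite_finite_induct) auto

lemma card_remove_plus_1:
  assumes "finite A" "x \<in> A"
  shows "card (A - {x}) + 1 = card A"
  using assms by (metis Suc_eq_plus1 card.remove)

lemma sum_trop_leI:
  fixes g :: "'i \<Rightarrow> trop"
  assumes "\<And>i. i \<in> I \<Longrightarrow> g i \<le> c"
  shows "sum g I \<le> c"
  using assms by (induction I rule: infinite_finite_induct) (auto simp: plus_trop_eq_max)

lemma member_le_sum_trop:
  fixes g :: "'i \<Rightarrow> trop"
  assumes "finite I" "i \<in> I"
  shows "g i \<le> sum g I"
  using assms by (simp add: sum.remove plus_trop_eq_max)

lemma sum_trop_const_if:
  fixes c :: trop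
  assumes "finite I" and "\<And>i. i \<in> I \<Longrightarrow> g i = (if P i then c else 0)"
  shows "sum g I = (if \<exists>i\<in>I. P i then c else 0)"
  using assms by (induction I rule: finite_induct) auto


section \<open>Submodules and tropical linear spaces\<close>

lemma lookup_smult [simp]: "lookup (smult c v) m = c * lookup v m"
  by (simp add: smult_def Poly_Mapping.map.rep_eq when_def)

lemma smult_single: "smult c (single i a) = single i (c * a)"
  by (rule poly_mapping_eqI) (simp add: lookup_single when_def)

lemma smult_add: "smult c (v + w) = smult c v + smult c w"
  by (rule poly_mapping_eqI) (simp add: lookup_add distrib_left)

lemma smult_smult [simp]: "smult c (smult d v) = smult (c * d) v"
  by (rule poly_mapping_eqI) (simp add: mult.assoc)

lemma smult_1 [simp]: "smult 1 v = v"
  by (rule poly_mapping_eqI) simp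

lemma smult_zero_right [simp]: "smult c 0 = 0"
  by (rule poly_mapping_eqI) simp

lemma smult_eq_mult:
  fixes v :: "('v, trop) polynomial"
  shows "smult c v = single 0 c * v"
  by (simp add: smult_def mult_map_scale_conv_mult)

lemma trop_submodule_hull [simp]: "trop_submodule (trop_submodule hull V)"
  by (rule hull_in) (auto simp: trop_submodule_def)

lemma trop_submodule_hull_0: "0 \<in> trop_submodule hull V"
  and trop_submodule_hull_add:
    "v \<in> trop_submodule hull V \<Longrightarrow> w \<in> trop_submodule hull V \<Longrightarrow> v + w \<in> trop_submodule hull V"
  and trop_submodule_hull_smult:
    "v \<in> trop_submodule hull V \<Longrightarrow> smult c v \<in> trop_submodule hull V"
  using trop_submodule_hull[of V] by (auto simp: trop_submodule_def)

lemma trop_submodule_sum: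
  assumes "trop_submodule M" "\<And>i. i \<in> I \<Longrightarrow> g i \<in> M"
  shows "sum g I \<in> M"
  using assms(2)
proof (induction I rule: infinite_finite_induct)
  case (insert x F)
  then show ?case
    using assms(1) by (auto simp: trop_submodule_def)
qed (use assms(1) in \<open>auto simp: trop_submodule_def\<close>)

lemma trop_submodule_hull_induct [consumes 1, case_names base zero add smult]:
  assumes "v \<in> trop_submodule hull V"
    and "\<And>v. v \<in> V \<Longrightarrow> P v" and "P 0"
    and "\<And>v w. P v \<Longrightarrow> P w \<Longrightarrow> P (v + w)" and "\<And>c v. P v \<Longrightarrow> P (smult c v)"
  shows "P v"
  by (rule hull_induct[OF assms(1)]) (use assms(2-) in \<open>auto simp: trop_submodule_def\<close>)

lemma trop_submodule_hull_empty: "trop_submodule hull {} = {0}"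
proof
  show "trop_submodule hull {} \<subseteq> {0}"
    by (rule hull_minimal) (auto simp: trop_submodule_def)
qed (auto intro: trop_submodule_hull_0)

lemma lookup_cocircuit:
  assumes "finite E"
  shows "lookup (cocircuit E p C) i = (if i \<in> E - C then p (insert i C) else 0)"
  using assms by (simp add: cocircuit_def lookup_sum lookup_single when_def sum.delta)

lemma keys_linear_space_of:
  assumes "finite E" "v \<in> linear_space_of E r p"
  shows "keys v \<subseteq> E"
proof -
  have "\<forall>i. i \<notin> E \<longrightarrow> lookup v i = 0"
    using assms(2) unfolding linear_space_of_def
    by (induction rule: trop_submodule_hull_induct) (auto simp: lookup_cocircuit[OF assms(1)] lookup_add)
  then show ?thesis
    by (auto simp: in_keys_iff)
qed

lemma smult_cocircuit_in_linear_space_of: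
  assumes "C \<subseteq> E" "card C + 1 = r"
  shows "smult c (cocircuit E p C) \<in> linear_space_of E r p"
  unfolding linear_space_of_def
  by (rule trop_submodule_hull_smult, rule hull_inc) (use assms in blast)

text \<open>
  For a cocircuit this is a Pluecker relation, and tropical vanishing is preserved by
  linear combinations.
\<close>

lemma linear_space_of_orthogonal:
  assumes p: "valuated_matroid E r p" and v: "v \<in> linear_space_of E r p"
    and A: "A \<subseteq> E" "card A = r + 1"
  shows "tropically_vanishes (\<lambda>i. lookup v i * p (A - {i})) A"
  using v unfolding linear_space_of_def
proof (induction rule: trop_submodule_hull_induct)
  case (base v)
  then obtain C where C: "C \<subseteq> E" "card C + 1 = r" and v: "v = cocircuit E p C"
    by auto
  have fin: "finite E" and finA: "finite A"
    using p A by (auto simp: valuated_matroid_def intro: finite_subset)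
  let ?g = "\<lambda>i. p (A - {i}) * p (insert i C)"
  have vanish: "tropically_vanishes ?g (A - C)"
    using p A C unfolding valuated_matroid_def by blast
  have eq: "sum (\<lambda>i. lookup v i * p (A - {i})) (A - X) = sum ?g (A - C - X)" for X
  proof -
    have "sum (\<lambda>i. lookup v i * p (A - {i})) (A - X)
        = sum (\<lambda>i. lookup v i * p (A - {i})) (A - C - X)"
      by (rule sum.mono_neutral_right) (use finA in \<open>auto simp: v lookup_cocircuit[OF fin]\<close>)
    also have "\<dots> = sum ?g (A - C - X)"
      by (rule sum.cong) (use A in \<open>auto simp: v lookup_cocircuit[OF fin] mult.commute\<close>)
    finally show ?thesis .
  qed
  show ?case
    unfolding tropically_vanishes_def
  proof
    fix j assume "j \<in> A"
    show "sum (\<lambda>i. lookup v i * p (A - {i})) (A - {j}) = sum (\<lambda>i. lookup v i * p (A - {i})) A"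
    proof (cases "j \<in> C")
      case True
      then have "A - C - {j} = A - C" by blast
      then show ?thesis using eq[of "{j}"] eq[of "{}"] by simp
    next
      case False
      then show ?thesis
        using vanish \<open>j \<in> A\<close> eq[of "{j}"] eq[of "{}"] by (simp add: tropically_vanishes_def)
    qed
  qed
next
  case (smult c v)
  then show ?case
    by (simp add: tropically_vanishes_def mult.assoc flip: sum_distrib_left)
qed (auto simp: tropically_vanishes_def lookup_add distrib_right sum.distrib)

text \<open>
  Orthogonality for a vector with two nonzero entries, for the sets \<open>B \<union> {i}\<close> and \<open>S \<union> {i, j}\<close>: every
  basis meets the support, and the values of \<open>p\<close> at the two completions of a set that avoids the
  support are proportional to the entries.
\<close>

lemma linear_space_of_pair:
  assumes p: "valuated_matroid E r p"
    and v: "single i \<alpha> + single j \<beta> \<in> linear_space_of E r p"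
    and ij: "i \<noteq> j" and nz: "\<alpha> \<noteq> 0" "\<beta> \<noteq> 0"
  shows "\<And>B. B \<subseteq> E \<Longrightarrow> card B = r \<Longrightarrow> i \<notin> B \<Longrightarrow> j \<notin> B \<Longrightarrow> p B = 0"
    and "\<And>S. S \<subseteq> E \<Longrightarrow> card S + 1 = r \<Longrightarrow> i \<notin> S \<Longrightarrow> j \<notin> S \<Longrightarrow>
      \<alpha> * p (insert j S) = \<beta> * p (insert i S)"
proof -
  let ?v = "single i \<alpha> + single j \<beta>"
  have fin: "finite E"
    using p by (simp add: valuated_matroid_def)
  have look: "lookup ?v m = (if m = i then \<alpha> else if m = j then \<beta> else 0)" for m
    using ij by (simp add: lookup_add lookup_single when_def)
  have ijE: "i \<in> E" "j \<in> E"
    using keys_linear_space_of[OF fin v] nz look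
    by (metis in_keys_iff subsetD ij)+
  note ortho = linear_space_of_orthogonal[OF p v]
  {
    fix B assume B: "B \<subseteq> E" "card B = r" "i \<notin> B" "j \<notin> B"
    have finB: "finite B"
      using B(1) fin by (rule finite_subset)
    have "tropically_vanishes (\<lambda>m. lookup ?v m * p (insert i B - {m})) (insert i B)"
      by (rule ortho) (use B ijE finB in auto)
    then have "sum (\<lambda>m. lookup ?v m * p (insert i B - {m})) B
        = sum (\<lambda>m. lookup ?v m * p (insert i B - {m})) (insert i B)"
      using B by (auto simp: tropically_vanishes_def)
    moreover have "sum (\<lambda>m. lookup ?v m * p (insert i B - {m})) B = 0"
      by (rule sum.neutral) (use B in \<open>auto simp: look\<close>)
    moreover have "sum (\<lambda>m. lookup ?v m * p (insert i B - {m})) (insert i B)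
        = \<alpha> * p B + sum (\<lambda>m. lookup ?v m * p (insert i B - {m})) B"
      using B finB by (simp add: look)
    ultimately have "\<alpha> * p B = 0"
      by simp
    with nz show "p B = 0"
      by simp
  }
  fix S assume S: "S \<subseteq> E" "card S + 1 = r" "i \<notin> S" "j \<notin> S"
  have finS: "finite S"
    using S(1) fin by (rule finite_subset)
  let ?A = "insert i (insert j S)"
  let ?h = "\<lambda>m. lookup ?v m * p (?A - {m})"
  have vanish: "tropically_vanishes ?h ?A"
    by (rule ortho) (use S ijE finS ij in auto)
  have "sum ?h (?A - {i}) = sum ?h (?A - {j})"
    using vanish by (simp add: tropically_vanishes_def)
  moreover have "?A - {i} = insert j S" "?A - {j} = insert i S"
    using S ij by auto
  moreover have "sum ?h S = 0"
    by (rule sum.neutral) (use S in \<open>auto simp: look\<close>)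
  moreover have "sum ?h (insert j S) = ?h j + sum ?h S" "sum ?h (insert i S) = ?h i + sum ?h S"
    using S finS by simp_all
  ultimately show "\<alpha> * p (insert j S) = \<beta> * p (insert i S)"
    using ij by (simp add: look)
qed

text \<open>
  The basis \<open>B\<close> contains \<open>j\<close> because it meets \<open>{i, j}\<close>. It contains \<open>k\<close>, since otherwise exchanging \<open>j\<close>
  for \<open>i\<close> would give a basis that avoids \<open>{j, k}\<close>. The vector sought is a multiple of the cocircuit of
  \<open>B - {k}\<close>.
\<close>

lemma eliminate_if_basis_avoids:
  assumes p: "valuated_matroid E r p"
    and v: "single i \<alpha> + single j \<beta> \<in> linear_space_of E r p"
    and w: "single j \<beta> + single k \<gamma> \<in> linear_space_of E r p"
    and dist: "i \<noteq> j" "j \<noteq> k" "i \<noteq> k" and nz: "\<alpha> \<noteq> 0" "\<beta> \<noteq> 0" "\<gamma> \<noteq> 0"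
    and B: "B \<subseteq> E" "card B = r" "p B \<noteq> 0" "i \<notin> B"
  shows "single i \<alpha> + single k \<gamma> \<in> linear_space_of E r p"
proof -
  have fin: "finite E"
    using p by (simp add: valuated_matroid_def)
  have look: "lookup (single i \<alpha> + single j \<beta>) i \<noteq> 0" "lookup (single j \<beta> + single k \<gamma>) k \<noteq> 0"
    using dist nz by (simp_all add: lookup_add lookup_single)
  have ikE: "i \<in> E" "k \<in> E"
    using keys_linear_space_of[OF fin v] keys_linear_space_of[OF fin w] look
    by (meson in_keys_iff subsetD)+
  note iv = linear_space_of_pair[OF p v dist(1) nz(1,2)]
  note jw = linear_space_of_pair[OF p w dist(2) nz(2,3)]
  have finB: "finite B"
    using B(1) fin by (rule finite_subset)
  have jB: "j \<in> B"
    using iv(1) B by blast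
  have kB: "k \<in> B"
  proof (rule ccontr)
    assume k: "k \<notin> B"
    have c: "card (B - {j}) + 1 = r"
      using card_remove_plus_1[OF finB jB] B(2) by simp
    have "\<alpha> * p (insert j (B - {j})) = \<beta> * p (insert i (B - {j}))"
      by (rule iv(2)) (use B c in auto)
    moreover have "p (insert i (B - {j})) = 0"
      by (rule jw(1)) (use B k c dist finB ikE in auto)
    ultimately show False
      using jB B nz by (simp add: insert_absorb)
  qed
  define C where "C = B - {k}"
  have C: "C \<subseteq> E" "card C + 1 = r" "i \<notin> C" "k \<notin> C" "j \<in> C" "insert k C = B"
    using B kB jB dist card_remove_plus_1[OF finB kB] unfolding C_def
    by (auto simp: insert_absorb)
  have finC: "finite C"
    using finB C_def by simp
  \<comment> \<open>The cocircuit of \<open>C\<close> is supported on \<open>i\<close> and \<open>k\<close>, since every basis meets \<open>{i, k}\<close>: one that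
    does not would contain \<open>j\<close>, which could be exchanged for \<open>i\<close>.\<close>
  have miss: "p (insert m C) = 0" if m: "m \<in> E - C" "m \<noteq> i" "m \<noteq> k" for m
  proof -
    define S where "S = insert m C - {j}"
    have S: "S \<subseteq> E" "card S + 1 = r" "i \<notin> S" "j \<notin> S" "k \<notin> S" "insert j S = insert m C"
      using C m finC dist card_remove_plus_1[of "insert m C" j] unfolding S_def by auto
    have "\<alpha> * p (insert j S) = \<beta> * p (insert i S)"
      by (rule iv(2)) (use S in auto)
    moreover have "p (insert i S) = 0"
      by (rule jw(1)) (use S ikE dist finC in \<open>auto simp: card_insert_if S_def\<close>)
    ultimately show ?thesis
      using S nz by simp
  qed
  have ratio: "\<alpha> * p B = \<gamma> * p (insert i C)"
  proof -
    define S where "S = C - {j}"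
    have S: "S \<subseteq> E" "card S + 2 = r" "i \<notin> S" "j \<notin> S" "k \<notin> S" "C = insert j S" "finite S"
      using C finC card_remove_plus_1[of C j] unfolding S_def by auto
    have "\<alpha> * p (insert j (insert k S)) = \<beta> * p (insert i (insert k S))"
      by (rule iv(2)) (use S ikE dist in auto)
    moreover have "\<beta> * p (insert k (insert i S)) = \<gamma> * p (insert j (insert i S))"
      by (rule jw(2)) (use S ikE dist in auto)
    moreover have "insert j (insert k S) = B" "insert j (insert i S) = insert i C"
      "insert i (insert k S) = insert k (insert i S)"
      using S(6) C(6) by auto
    ultimately show ?thesis
      by simp
  qed
  obtain c where c: "c * p B = 1"
    using trop_inverse[OF B(3)] by blast
  have "smult (c * \<gamma>) (cocircuit E p C) = single i \<alpha> + single k \<gamma>"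
  proof (rule poly_mapping_eqI)
    fix m
    consider "m = i" | "m = k" | "m \<noteq> i" "m \<noteq> k" by blast
    then show "lookup (smult (c * \<gamma>) (cocircuit E p C)) m = lookup (single i \<alpha> + single k \<gamma>) m"
    proof cases
      case 1
      have "c * \<gamma> * p (insert i C) = c * (\<alpha> * p B)"
        by (simp add: mult.assoc ratio)
      also have "\<dots> = c * p B * \<alpha>"
        by (simp add: mult_ac)
      finally have "c * \<gamma> * p (insert i C) = \<alpha>"
        by (simp add: c)
      with 1 show ?thesis
        using C ikE dist by (simp add: lookup_cocircuit[OF fin] lookup_add lookup_single)
    next
      case 2
      have "c * \<gamma> * p B = c * p B * \<gamma>"
        by (simp add: mult_ac)
      then have "c * \<gamma> * p B = \<gamma>"
        by (simp add: c)
      with 2 show ?thesis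
        using C ikE dist by (simp add: lookup_cocircuit[OF fin] lookup_add lookup_single)
    next
      case 3
      with miss show ?thesis
        by (auto simp: lookup_cocircuit[OF fin] lookup_add lookup_single)
    qed
  qed
  then show ?thesis
    using smult_cocircuit_in_linear_space_of[OF C(1,2), of "c * \<gamma>" p] by simp
qed

text \<open>
  A special case of vector elimination in tropical linear spaces. If some basis avoids one of \<open>i\<close>
  and \<open>k\<close>, it contains the other, and removing that one leaves a set whose cocircuit is a multiple
  of the vector sought. Otherwise \<open>i\<close> and \<open>k\<close> are coloops and both unit vectors belong to the space.
\<close>

lemma tropical_linear_space_eliminate:
  assumes L: "tropical_linear_space E L"
    and v: "single i \<alpha> + single j \<beta> \<in> L" and w: "single j \<beta> + single k \<gamma> \<in> L"
    and dist: "i \<noteq> j" "j \<noteq> k" "i \<noteq> k" and nz: "\<alpha> \<noteq> 0" "\<beta> \<noteq> 0" "\<gamma> \<noteq> 0"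
  shows "single i \<alpha> + single k \<gamma> \<in> L"
proof -
  obtain r p where p: "valuated_matroid E r p" and L: "L = linear_space_of E r p"
    using L by (auto simp: tropical_linear_space_def)
  note vw = v[unfolded L] w[unfolded L]
  have fin: "finite E"
    using p by (simp add: valuated_matroid_def)
  obtain B where B: "B \<subseteq> E" "card B = r" "p B \<noteq> 0"
    using p by (auto simp: valuated_matroid_def)
  show ?thesis
  proof (cases "\<exists>B\<subseteq>E. card B = r \<and> p B \<noteq> 0 \<and> (i \<notin> B \<or> k \<notin> B)")
    case True
    then obtain B where "B \<subseteq> E" "card B = r" "p B \<noteq> 0" "i \<notin> B \<or> k \<notin> B"
      by blast
    then show ?thesis
      using eliminate_if_basis_avoids[OF p vw dist nz, of B]
        eliminate_if_basis_avoids[OF p, of k \<gamma> j \<beta> i \<alpha> B] vw dist nz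
      unfolding L by (auto simp: add.commute)
  next
    case False
    have unit: "single m \<mu> \<in> linear_space_of E r p" if m: "m = i \<or> m = k" for m \<mu>
    proof -
      have all: "\<And>B. B \<subseteq> E \<Longrightarrow> card B = r \<Longrightarrow> m \<notin> B \<Longrightarrow> p B = 0"
        using False m by blast
      define C where "C = B - {m}"
      have mB: "m \<in> B"
        using all B by blast
      have finB: "finite B"
        using B(1) fin by (rule finite_subset)
      have C: "C \<subseteq> E" "card C + 1 = r" "m \<notin> C" "insert m C = B" "finite C"
        using B finB card_remove_plus_1[OF finB mB] mB unfolding C_def
        by (auto simp: insert_absorb)
      obtain c where c: "c * p B = 1"
        using trop_inverse[OF B(3)] by blast
      have zero: "p (insert l C) = 0" if "l \<in> E - C" "l \<noteq> m" for l
        by (rule all) (use C that in auto)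
      have "smult (\<mu> * c) (cocircuit E p C) = single m \<mu>"
      proof (rule poly_mapping_eqI)
        fix l
        have "\<mu> * c * p B = \<mu>"
          using c by (simp add: mult.assoc)
        then show "lookup (smult (\<mu> * c) (cocircuit E p C)) l = lookup (single m \<mu>) l"
          using zero[of l] C mB B by (auto simp: lookup_cocircuit[OF fin] lookup_single when_def)
      qed
      then show ?thesis
        using smult_cocircuit_in_linear_space_of[OF C(1,2), of "\<mu> * c" p] by simp
    qed
    show ?thesis
      using unit unfolding L linear_space_of_def by (intro trop_submodule_hull_add) auto
  qed
qed

section \<open>Matroids rescaled by a potential\<close>

text \<open>
  Weighting every basis \<open>B\<close> by a product over \<open>B\<close> multiplies all terms
  $p_{A \setminus i} \, p_{C \cup i}$ of a Pluecker relation by the same constant, so the relation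
  only says that the number of nonzero terms is not one.
\<close>

lemma valuated_matroid_rescaled:
  fixes basis :: "'a set \<Rightarrow> bool" and \<phi> :: "'a \<Rightarrow> trop"
  assumes fin: "finite E"
    and p: "\<And>B. B \<subseteq> E \<Longrightarrow> p B = (if basis B then c * prod \<phi> B else 0)"
    and nz: "c \<noteq> 0" "\<And>i. \<phi> i \<noteq> 0"
    and nonempty: "\<exists>B\<subseteq>E. card B = r \<and> basis B"
    and exchange: "\<And>A C i. A \<subseteq> E \<Longrightarrow> C \<subseteq> E \<Longrightarrow> i \<in> A - C \<Longrightarrow> basis (A - {i}) \<Longrightarrow> basis (insert i C) \<Longrightarrow>
      \<exists>j\<in>A - C. j \<noteq> i \<and> basis (A - {j}) \<and> basis (insert j C)"
  shows "valuated_matroid E r p"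
  unfolding valuated_matroid_def
proof (intro conjI allI impI)
  show "\<exists>B\<subseteq>E. card B = r \<and> p B \<noteq> 0"
  proof -
    obtain B where B: "B \<subseteq> E" "card B = r" "basis B"
      using nonempty by blast
    then have "p B \<noteq> 0"
      using nz prod_trop_nonzero[of B \<phi>] by (simp add: p)
    with B show ?thesis
      by blast
  qed
  fix A C assume AC: "A \<subseteq> E \<and> card A = r + 1 \<and> C \<subseteq> E \<and> card C + 1 = r"
  then have finA: "finite A" and finC: "finite C"
    using fin by (auto intro: finite_subset)
  define k where "k = c * c * (prod \<phi> A * prod \<phi> C)"
  define P where "P i \<longleftrightarrow> basis (A - {i}) \<and> basis (insert i C)" for i
  let ?g = "\<lambda>i. p (A - {i}) * p (insert i C)"
  have g: "?g i = (if P i then k else 0)" if "i \<in> A - C" for i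
  proof -
    have "prod \<phi> A = \<phi> i * prod \<phi> (A - {i})" "prod \<phi> (insert i C) = \<phi> i * prod \<phi> C"
      using that finA finC by (auto simp: prod.remove)
    moreover have "p (A - {i}) = (if basis (A - {i}) then c * prod \<phi> (A - {i}) else 0)"
      "p (insert i C) = (if basis (insert i C) then c * prod \<phi> (insert i C) else 0)"
      using AC that by (intro p; auto)+
    ultimately show ?thesis
      by (simp add: P_def k_def mult_ac)
  qed
  show "tropically_vanishes ?g (A - C)"
    unfolding tropically_vanishes_def
  proof
    fix j assume "j \<in> A - C"
    have "sum ?g (A - C) = (if \<exists>i\<in>A - C. P i then k else 0)"
      by (rule sum_trop_const_if) (use finA g in auto)
    moreover have "sum ?g (A - C - {j}) = (if \<exists>i\<in>A - C - {j}. P i then k else 0)"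
      by (rule sum_trop_const_if) (use finA g in auto)
    moreover have "(\<exists>i\<in>A - C. P i) \<longleftrightarrow> (\<exists>i\<in>A - C - {j}. P i)"
      using exchange AC unfolding P_def by blast
    ultimately show "sum ?g (A - C - {j}) = sum ?g (A - C)"
      by simp
  qed
qed (rule fin)

text \<open>
  The direct sum of the uniform matroids of corank one on the classes of an equivalence
  relation. Complements of bases are the transversals of the partition.
\<close>

definition partition_basis :: "'a set \<Rightarrow> ('a \<Rightarrow> 'a \<Rightarrow> bool) \<Rightarrow> 'a set \<Rightarrow> bool"
  where "partition_basis E R B \<longleftrightarrow> B \<subseteq> E \<and> (\<forall>m\<in>E. \<exists>!j. j \<in> E - B \<and> R j m)"

lemma partition_basis_exists:
  assumes R: "equivp R" and a: "a \<in> E"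
  shows "\<exists>B. partition_basis E R B \<and> a \<notin> B"
proof -
  note refl = equivp_reflp[OF R] and sym = equivp_symp[OF R] and trans = equivp_transp[OF R]
  define f where "f m = (if R a m then a else SOME j. j \<in> E \<and> R j m)" for m
  have f: "f m \<in> E \<and> R (f m) m" if "m \<in> E" for m
    using someI[of "\<lambda>j. j \<in> E \<and> R j m" m] that refl a unfolding f_def by auto
  have f_cong: "f m = f m'" if "R m m'" for m m'
  proof -
    have "(\<lambda>j. R j m) = (\<lambda>j. R j m')"
      using that sym trans by blast
    then show ?thesis
      unfolding f_def by metis
  qed
  have "\<exists>!j. j \<in> f ` E \<and> R j m" if m: "m \<in> E" for m
  proof (rule ex1I[of _ "f m"])
    show "f m \<in> f ` E \<and> R (f m) m"
      using f m by auto
    fix j assume "j \<in> f ` E \<and> R j m"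
    then obtain m' where m': "m' \<in> E" "j = f m'" "R j m"
      by auto
    then have "R m' m"
      using f sym trans by blast
    with m' f_cong show "j = f m"
      by blast
  qed
  moreover have "E - (E - f ` E) = f ` E"
    using f by blast
  ultimately have "partition_basis E R (E - f ` E)"
    unfolding partition_basis_def by (metis Diff_subset)
  moreover have "a = f a"
    using refl by (simp add: f_def)
  ultimately show ?thesis
    using a by (metis DiffD2 imageI)
qed

text \<open>
  One class has two elements outside \<open>C\<close>, all others have one.
\<close>

lemma partition_basis_partner:
  assumes R: "equivp R" and B: "partition_basis E R (insert i C)" and i: "i \<in> E - C"
  obtains k where "k \<in> E - C" "k \<noteq> i" "R i k" "\<And>j. j \<in> E - C \<Longrightarrow> R i j \<Longrightarrow> j = i \<or> j = k"
proof -
  note sym = equivp_symp[OF R]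
  have "\<exists>!k. k \<in> E - insert i C \<and> R k i"
    using B i unfolding partition_basis_def by blast
  then obtain k where "k \<in> E - insert i C" "R k i"
    "\<And>j. j \<in> E - insert i C \<Longrightarrow> R j i \<Longrightarrow> j = k"
    by blast
  then show ?thesis
    using that[of k] sym by blast
qed

text \<open>
  The two elements of that class outside \<open>C\<close> are the only ones whose addition gives a basis. This is
  used in both directions: it gives the supports of cocircuits, and it provides the second
  nonzero term in a Pluecker relation.
\<close>

lemma partition_basis_swap:
  assumes R: "equivp R" and B: "partition_basis E R (insert i C)" and i: "i \<in> E - C"
    and j: "j \<in> E - C"
  shows "partition_basis E R (insert j C) \<longleftrightarrow> R i j"
proof -
  note refl = equivp_reflp[OF R] and sym = equivp_symp[OF R] and trans = equivp_transp[OF R]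
  obtain k where k: "k \<in> E - C" "k \<noteq> i" "R i k"
    and ik: "\<And>j. j \<in> E - C \<Longrightarrow> R i j \<Longrightarrow> j = i \<or> j = k"
    using partition_basis_partner[OF R B i] by blast
  show ?thesis
  proof
    assume "partition_basis E R (insert j C)"
    then have "\<exists>!l. l \<in> E - insert j C \<and> R l i"
      using i unfolding partition_basis_def by blast
    then show "R i j"
      using i k refl sym by blast
  next
    assume ij: "R i j"
    have "\<exists>!l. l \<in> E - insert j C \<and> R l m" if m: "m \<in> E" for m
    proof (cases "R i m")
      case True
      have eq: "l \<in> E - C \<and> R l m \<longleftrightarrow> l = i \<or> l = k" for l
        using True ik k i sym trans by blast
      have "j = i \<or> j = k"
        using ik ij j by blast
      then show ?thesis
        using eq k(2) by (metis DiffI DiffD1 DiffD2 insert_iff)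
    next
      case False
      have "\<exists>!l. l \<in> E - insert i C \<and> R l m"
        using B m unfolding partition_basis_def by blast
      moreover have "(\<lambda>l. l \<in> E - insert i C \<and> R l m) = (\<lambda>l. l \<in> E - insert j C \<and> R l m)"
      proof (intro ext)
        fix l
        have "\<not> R j m"
          using False ij trans by blast
        with False show "l \<in> E - insert i C \<and> R l m \<longleftrightarrow> l \<in> E - insert j C \<and> R l m"
          by auto
      qed
      ultimately show ?thesis
        by (simp only:)
    qed
    moreover have "insert j C \<subseteq> E"
      using B j by (auto simp: partition_basis_def)
    ultimately show "partition_basis E R (insert j C)"
      by (simp only: partition_basis_def simp_thms ball_simps) (intro ballI)
  qed
qed

context
  fixes E :: "'a set" and R :: "'a \<Rightarrow> 'a \<Rightarrow> bool" and p :: "'a set \<Rightarrow> trop"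
    and c :: trop and \<phi> :: "'a \<Rightarrow> trop" and r :: nat
  assumes fin: "finite E" and R: "equivp R"
    and p: "\<And>B. B \<subseteq> E \<Longrightarrow> p B = (if partition_basis E R B then c * prod \<phi> B else 0)"
    and nz: "c \<noteq> 0" "\<And>i. \<phi> i \<noteq> 0"
    and rank: "\<And>B. partition_basis E R B \<Longrightarrow> card B = r"
begin

lemma valuated_matroid_partition: "valuated_matroid E r p"
proof (rule valuated_matroid_rescaled[OF fin p nz])
  have "\<exists>B. partition_basis E R B"
  proof (cases "E = {}")
    case False
    then show ?thesis
      using partition_basis_exists[OF R] by blast
  next
    case True
    then have "partition_basis E R {}"
      by (simp add: partition_basis_def)
    then show ?thesis ..
  qed
  then show "\<exists>B\<subseteq>E. card B = r \<and> partition_basis E R B"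
    using rank unfolding partition_basis_def by blast
next
  fix A C i
  assume A: "A \<subseteq> E" and C: "C \<subseteq> E" and i: "i \<in> A - C"
    and Ai: "partition_basis E R (A - {i})" and iC: "partition_basis E R (insert i C)"
  obtain k where k: "k \<in> E - C" "k \<noteq> i" "R i k"
    using partition_basis_partner[OF R iC, of thesis] i A by blast
  have "\<exists>!l. l \<in> E - (A - {i}) \<and> R l i"
    using Ai A i unfolding partition_basis_def by blast
  moreover have "R k i" "R i i"
    using k equivp_reflp[OF R] equivp_symp[OF R] by blast+
  ultimately have kA: "k \<in> A"
    using k i A by blast
  have "partition_basis E R (insert i (A - {i, k})) \<longleftrightarrow> R k i"
  proof (rule partition_basis_swap[OF R])
    have "insert k (A - {i, k}) = A - {i}"
      using k kA by blast
    with Ai show "partition_basis E R (insert k (A - {i, k}))"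
      by simp
  qed (use kA A i in auto)
  moreover have "insert i (A - {i, k}) = A - {k}"
    using k i by blast
  moreover have "R k i"
    using k equivp_symp[OF R] by blast
  moreover have "partition_basis E R (insert k C)"
    using partition_basis_swap[OF R iC, of k] k i A by blast
  ultimately show "\<exists>j\<in>A - C. j \<noteq> i \<and> partition_basis E R (A - {j}) \<and> partition_basis E R (insert j C)"
    using k kA by auto
qed

lemma cocircuit_partition:
  assumes B: "partition_basis E R (insert i C)" and i: "i \<in> E - C"
    and k: "k \<in> E - C" "k \<noteq> i" "R i k"
  shows "cocircuit E p C = smult (c * prod \<phi> C) (single i (\<phi> i) + single k (\<phi> k))"
proof (rule poly_mapping_eqI)
  fix j
  have C: "C \<subseteq> E"
    using B unfolding partition_basis_def by blast
  have finC: "finite C"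
    using C fin by (rule finite_subset)
  obtain k' where k': "k' \<in> E - C" "k' \<noteq> i" "R i k'"
    and ik: "\<And>j. j \<in> E - C \<Longrightarrow> R i j \<Longrightarrow> j = i \<or> j = k'"
    using partition_basis_partner[OF R B i] by blast
  have [simp]: "k' = k"
    using ik k by blast
  show "lookup (cocircuit E p C) j
      = lookup (smult (c * prod \<phi> C) (single i (\<phi> i) + single k (\<phi> k))) j"
  proof (cases "j \<in> E - C")
    case True
    have pj: "p (insert j C) = (if R i j then c * prod \<phi> (insert j C) else 0)"
      unfolding partition_basis_swap[OF R B i True, symmetric] by (rule p) (use C True in auto)
    have Rij: "R i j \<longleftrightarrow> j = i \<or> j = k"
      using ik True k equivp_reflp[OF R] by blast
    have "lookup (cocircuit E p C) j = (if j = i \<or> j = k then c * prod \<phi> (insert j C) else 0)"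
      using True by (simp only: lookup_cocircuit[OF fin] pj Rij if_True)
    also have "prod \<phi> (insert j C) = prod \<phi> C * \<phi> j"
      using True finC by (simp add: mult.commute)
    finally show ?thesis
      using k(2) by (cases "j = i") (simp_all add: lookup_add lookup_single when_def mult.assoc)
  next
    case False
    then show ?thesis
      using i k by (auto simp: lookup_cocircuit[OF fin] lookup_add lookup_single when_def)
  qed
qed

lemma linear_space_of_partition:
  "linear_space_of E r p =
    trop_submodule hull {single i (\<phi> i) + single j (\<phi> j) | i j. i \<in> E \<and> j \<in> E \<and> i \<noteq> j \<and> R i j}"
    (is "_ = trop_submodule hull ?V")
proof
  show "linear_space_of E r p \<subseteq> trop_submodule hull ?V"
    unfolding linear_space_of_def
  proof (rule hull_minimal, safe)
    fix C assume C: "C \<subseteq> E"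
    show "cocircuit E p C \<in> trop_submodule hull ?V"
    proof (cases "\<exists>i\<in>E - C. partition_basis E R (insert i C)")
      case True
      then obtain i where i: "i \<in> E - C" "partition_basis E R (insert i C)"
        by blast
      then obtain k where k: "k \<in> E - C" "k \<noteq> i" "R i k"
        using partition_basis_partner[OF R, of E i C thesis] by blast
      then have "single i (\<phi> i) + single k (\<phi> k) \<in> trop_submodule hull ?V"
        using i by (intro hull_inc) blast
      then show ?thesis
        unfolding cocircuit_partition[OF i(2,1) k] by (rule trop_submodule_hull_smult)
    next
      case False
      then have "p (insert i C) = 0" if "i \<in> E - C" for i
        using p[of "insert i C"] that C by auto
      then have "cocircuit E p C = 0"
        by (intro poly_mapping_eqI) (auto simp: lookup_cocircuit[OF fin])
      then show ?thesis
        by (simp add: trop_submodule_hull_0)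
    qed
  qed (rule trop_submodule_hull)
  have "single i (\<phi> i) + single j (\<phi> j) \<in> linear_space_of E r p"
    if ij: "i \<in> E" "j \<in> E" "i \<noteq> j" "R i j" for i j
  proof -
    obtain B where B: "partition_basis E R B" "j \<notin> B"
      using partition_basis_exists[OF R ij(2)] by blast
    have "\<exists>!l. l \<in> E - B \<and> R l j"
      using B ij unfolding partition_basis_def by blast
    moreover have "j \<in> E - B \<and> R j j"
      using ij B equivp_reflp[OF R] by blast
    ultimately have iB: "i \<in> B"
      using ij by (metis DiffI)
    define C where "C = B - {i}"
    have C: "insert i C = B" "i \<notin> C" "j \<notin> C" "C \<subseteq> E"
      using iB B unfolding C_def partition_basis_def by auto
    have finB: "finite B"
      using B fin unfolding partition_basis_def by (blast intro: finite_subset)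
    have r: "card C + 1 = r"
      using card_remove_plus_1[OF finB iB] rank[OF B(1)] by (simp add: C_def)
    have "cocircuit E p C = smult (c * prod \<phi> C) (single i (\<phi> i) + single j (\<phi> j))"
      by (rule cocircuit_partition) (use B C ij in auto)
    moreover have "c * prod \<phi> C \<noteq> 0"
      using nz prod_trop_nonzero[of C \<phi>] by simp
    then obtain d where "d * (c * prod \<phi> C) = 1"
      by (rule trop_inverse)
    ultimately have "smult d (cocircuit E p C) = single i (\<phi> i) + single j (\<phi> j)"
      by simp
    then show ?thesis
      using smult_cocircuit_in_linear_space_of[OF C(4) r, of d p] by simp
  qed
  then have "?V \<subseteq> linear_space_of E r p"
    by auto
  then show "trop_submodule hull ?V \<subseteq> linear_space_of E r p"
    by (rule hull_minimal) (simp add: linear_space_of_def)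
qed

end

section \<open>Maximal minors and matchings in unions of paths\<close>

text \<open>
  If the nonzero entries of a matrix are products of a row weight and a column weight, then all
  nonzero terms of a maximal minor have the same value.
\<close>

lemma maximal_minor_rescaled:
  assumes fin: "finite R"
    and D: "\<And>X Y. X \<in> R \<Longrightarrow> D X Y = (if N X Y then \<kappa> X * \<phi> Y else 0)"
  shows "maximal_minor D R B =
    (if \<exists>\<sigma>. bij_betw \<sigma> R B \<and> (\<forall>X\<in>R. N X (\<sigma> X)) then prod \<kappa> R * prod \<phi> B else 0)"
proof -
  let ?S = "{\<sigma> \<in> R \<rightarrow>\<^sub>E B. bij_betw \<sigma> R B}"
  have finS: "finite ?S"
  proof (cases "finite B")
    case True
    then show ?thesis
      by (intro finite_subset[of ?S "R \<rightarrow>\<^sub>E B"] finite_PiE fin) auto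
  next
    case False
    then have "?S = {}"
      using fin bij_betw_finite by auto
    then show ?thesis
      by (simp only: finite.emptyI)
  qed
  have term_eq: "(\<Prod>X\<in>R. D X (\<sigma> X)) = (if \<forall>X\<in>R. N X (\<sigma> X) then prod \<kappa> R * prod \<phi> B else 0)"
    if "\<sigma> \<in> ?S" for \<sigma>
  proof (cases "\<forall>X\<in>R. N X (\<sigma> X)")
    case True
    then have "(\<Prod>X\<in>R. D X (\<sigma> X)) = (\<Prod>X\<in>R. \<kappa> X * \<phi> (\<sigma> X))"
      by (intro prod.cong) (auto simp: D)
    also have "\<dots> = prod \<kappa> R * (\<Prod>X\<in>R. \<phi> (\<sigma> X))"
      by (rule prod.distrib)
    also have "(\<Prod>X\<in>R. \<phi> (\<sigma> X)) = prod \<phi> B"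
      using that by (intro prod.reindex_bij_betw) auto
    finally show ?thesis
      using True by simp
  next
    case False
    then obtain X where X: "X \<in> R" "D X (\<sigma> X) = 0"
      using D by auto
    then have "(\<Prod>X\<in>R. D X (\<sigma> X)) = 0"
      using fin by (simp add: prod.remove)
    with False show ?thesis
      by auto
  qed
  have "(\<exists>\<sigma>\<in>?S. \<forall>X\<in>R. N X (\<sigma> X)) \<longleftrightarrow> (\<exists>\<sigma>. bij_betw \<sigma> R B \<and> (\<forall>X\<in>R. N X (\<sigma> X)))" (is "?L \<longleftrightarrow> ?R")
  proof
    assume ?R
    then obtain \<sigma> where \<sigma>: "bij_betw \<sigma> R B" "\<forall>X\<in>R. N X (\<sigma> X)"
      by blast
    have "bij_betw (restrict \<sigma> R) R B"
      using \<sigma>(1) by (simp cong: bij_betw_cong)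
    moreover have "restrict \<sigma> R \<in> R \<rightarrow>\<^sub>E B"
      using \<sigma>(1) by (auto simp: bij_betw_def)
    ultimately show ?L
      using \<sigma>(2) by (intro bexI[of _ "restrict \<sigma> R"]) auto
  qed blast
  then show ?thesis
    unfolding maximal_minor_def using sum_trop_const_if[OF finS term_eq] by simp
qed

text \<open>
  A graph with edges from \<open>s X\<close> to \<open>t X\<close>. Injectivity of \<open>s\<close> and \<open>t\<close> and the height function make
  it a disjoint union of directed paths.
\<close>

locale path_forest =
  fixes s t :: "'r \<Rightarrow> 'a" and h :: "'a \<Rightarrow> nat"
  assumes inj_s: "inj s" and inj_t: "inj t" and height: "h (s X) < h (t X)"
begin

definition reach :: "'a \<Rightarrow> 'a \<Rightarrow> bool"
  where "reach = (\<lambda>i j. \<exists>X. i = s X \<and> j = t X)\<^sup>*\<^sup>*"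

text \<open>
  In a union of paths, comparability is already transitive and therefore describes the
  connected components.
\<close>

definition conn :: "'a \<Rightarrow> 'a \<Rightarrow> bool"
  where "conn i j \<longleftrightarrow> reach i j \<or> reach j i"

lemma reach_refl [simp]: "reach i i"
  by (simp add: reach_def)

lemma reach_trans: "reach i j \<Longrightarrow> reach j k \<Longrightarrow> reach i k"
  unfolding reach_def by (rule rtranclp_trans)

lemma reach_edge: "reach (s X) (t X)"
  unfolding reach_def by (rule r_into_rtranclp) blast

lemma reach_induct [consumes 1, case_names refl step]:
  assumes "reach i j" "P i" "\<And>X. reach i (s X) \<Longrightarrow> P (s X) \<Longrightarrow> P (t X)"
  shows "P j"
  using assms(1) unfolding reach_def
  by (induction rule: rtranclp_induct) (use assms(2,3) in \<open>auto simp: reach_def\<close>)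

lemma reach_height: "reach i j \<Longrightarrow> i = j \<or> h i < h j"
proof (induction rule: reach_induct)
  case (step X)
  then show ?case
    using height[of X] by auto
qed simp

lemma not_reach_back: "\<not> reach (t X) (s X)"
  using reach_height[of "t X" "s X"] height[of X] by auto

lemma reach_from_source: "reach (s X) j \<Longrightarrow> j = s X \<or> reach (t X) j"
proof (induction rule: reach_induct)
  case (step Y)
  then show ?case
    using inj_s by (metis injD reach_edge reach_refl reach_trans)
qed simp

lemma reach_to_target: "reach i (t X) \<Longrightarrow> i = t X \<or> reach i (s X)"
proof -
  have "reach i j \<Longrightarrow> j = t X \<longrightarrow> i = t X \<or> reach i (s X)" for j
    by (induction rule: reach_induct) (use inj_t in \<open>auto dest: injD\<close>)
  then show "reach i (t X) \<Longrightarrow> ?thesis"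
    by blast
qed

lemma reach_comparable_from: "reach i j \<Longrightarrow> reach i k \<Longrightarrow> conn j k"
proof (induction rule: reach_induct)
  case (step X)
  then show ?case
    unfolding conn_def using reach_from_source[of X k] reach_edge[of X] reach_trans by blast
qed (simp add: conn_def)

lemma reach_comparable_to:
  assumes "reach j i" "reach k i"
  shows "conn j k"
  using assms
proof (induction rule: reach_induct)
  case (step X)
  show ?case
  proof (cases "k = t X")
    case True
    then show ?thesis
      using step.hyps reach_edge[of X] reach_trans by (auto simp: conn_def)
  qed (use step reach_to_target[of k X] in blast)
qed (simp add: conn_def)

lemma equivp_conn: "equivp conn"
proof (rule equivpI)
  show "transp conn"
  proof (rule transpI)
    fix i j k assume "conn i j" "conn j k"
    then show "conn i k"
      using reach_comparable_from[of j i k] reach_comparable_to[of i j k] reach_trans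
      unfolding conn_def by blast
  qed
qed (auto simp: conn_def intro: reflpI sympI)

lemmas conn_refl = equivp_reflp[OF equivp_conn]
  and conn_sym = equivp_symp[OF equivp_conn]
  and conn_trans = equivp_transp[OF equivp_conn]

lemma conn_edge: "conn (s X) (t X)"
  using reach_edge by (simp add: conn_def)

lemma conn_map:
  assumes "conn i j" and "\<And>X. \<exists>Y. f (s X) = s Y \<and> f (t X) = t Y"
  shows "conn (f i) (f j)"
proof -
  have "reach i j \<Longrightarrow> reach (f i) (f j)" for i j
    by (induction rule: reach_induct) (simp, metis assms(2) reach_edge reach_trans)
  then show ?thesis
    using assms(1) by (auto simp: conn_def)
qed

context
  fixes E :: "'a set" and R :: "'r set"
  assumes finE: "finite E" and sE: "\<And>X. s X \<in> E \<longleftrightarrow> X \<in> R" and tE: "\<And>X. t X \<in> E \<longleftrightarrow> X \<in> R"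
begin

text \<open>
  Every edge is matched with its end facing away from the root of its path, the root being the
  vertex of the path outside \<open>B\<close>.
\<close>

lemma partition_basis_imp_matching:
  assumes B: "partition_basis E conn B"
  shows "\<exists>\<sigma>. bij_betw \<sigma> R B \<and> (\<forall>X\<in>R. \<sigma> X = s X \<or> \<sigma> X = t X)"
proof -
  have BE: "B \<subseteq> E"
    using B by (simp add: partition_basis_def)
  have "\<exists>r. r \<in> E - B \<and> conn r m \<and> (\<forall>j. j \<in> E - B \<and> conn j m \<longrightarrow> j = r)" if "m \<in> E" for m
    using B that unfolding partition_basis_def by (auto elim!: ballE ex1E)
  then obtain root where "\<And>m. m \<in> E \<Longrightarrow> root m \<in> E - B \<and> conn (root m) m \<and>
      (\<forall>j. j \<in> E - B \<and> conn j m \<longrightarrow> j = root m)"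
    by metis
  then have root: "\<And>m. m \<in> E \<Longrightarrow> root m \<in> E - B" "\<And>m. m \<in> E \<Longrightarrow> conn (root m) m"
    and root_unique: "\<And>m j. m \<in> E \<Longrightarrow> j \<in> E - B \<Longrightarrow> conn j m \<Longrightarrow> j = root m"
    by blast+
  have root_cong: "root i = root j" if "i \<in> E" "j \<in> E" "conn i j" for i j
    using root[OF that(1)] root_unique[OF that(2)] conn_trans[OF _ that(3)] by blast
  define \<sigma> where "\<sigma> X = (if reach (t X) (root (s X)) then s X else t X)" for X
  have up: "reach (root (s X)) (s X)" if "X \<in> R" "\<not> reach (t X) (root (s X))" for X
  proof -
    have "conn (root (s X)) (t X)"
      using root(2)[of "s X"] conn_edge conn_trans sE that by blast
    then have "reach (root (s X)) (t X)"
      using that by (auto simp: conn_def)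
    then show ?thesis
      using reach_to_target that(2) by (metis reach_refl)
  qed
  have mem: "\<sigma> X \<in> B" if X: "X \<in> R" for X
  proof (rule ccontr)
    assume out: "\<sigma> X \<notin> B"
    have st: "s X \<in> E" "t X \<in> E"
      using X sE tE by auto
    show False
    proof (cases "reach (t X) (root (s X))")
      case True
      then have "s X = root (s X)"
        using out st root_unique[of "s X" "s X"] conn_refl by (auto simp: \<sigma>_def)
      with True show False
        using not_reach_back by metis
    next
      case False
      then have "t X = root (s X)"
        using out st root_unique[of "s X" "t X"] conn_sym[OF conn_edge] by (auto simp: \<sigma>_def)
      with False show False
        by simp
    qed
  qed
  have no_clash: False
    if "X \<in> R" "Y \<in> R" "s X = t Y" "reach (t X) (root (s X))" "\<not> reach (t Y) (root (s Y))" for X Y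
  proof -
    have "root (s X) = root (s Y)"
      using that root_cong[of "s Y" "t Y"] sE tE conn_edge by metis
    then have "reach (t X) (s Y)"
      using that(4) up[OF that(2,5)] reach_trans by metis
    then show False
      using that(3) reach_edge[of Y] reach_trans not_reach_back[of X] by metis
  qed
  have "inj_on \<sigma> R"
  proof (rule inj_onI)
    fix X Y assume XY: "X \<in> R" "Y \<in> R" "\<sigma> X = \<sigma> Y"
    show "X = Y"
      using XY(3) no_clash[OF XY(1,2)] no_clash[OF XY(2,1)] injD[OF inj_s] injD[OF inj_t]
      unfolding \<sigma>_def by (metis (full_types))
  qed
  moreover have "B \<subseteq> \<sigma> ` R"
  proof
    fix m assume m: "m \<in> B"
    then have mE: "m \<in> E"
      using BE by blast
    have neq: "root m \<noteq> m"
      using root(1)[OF mE] m by auto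
    consider "reach m (root m)" | "reach (root m) m"
      using root(2)[OF mE] by (auto simp: conn_def)
    then show "m \<in> \<sigma> ` R"
    proof cases
      case 1
      with neq obtain X where X: "m = s X"
        unfolding reach_def by (auto elim: converse_rtranclpE)
      with 1 neq have "reach (t X) (root m)"
        using reach_from_source by blast
      then show ?thesis
        using X mE sE by (auto simp: \<sigma>_def)
    next
      case 2
      with neq obtain X where X: "m = t X"
        unfolding reach_def by (auto elim: rtranclp.cases)
      then have XR: "X \<in> R"
        using mE tE by blast
      have "root (s X) = root m"
        using root_cong[of "s X" "t X"] X XR sE tE conn_edge by blast
      moreover have "\<not> reach (t X) (root m)"
        using 2 X neq reach_height by (metis less_asym)
      ultimately show ?thesis
        using X XR by (auto simp: \<sigma>_def)
    qed
  qed
  ultimately have "bij_betw \<sigma> R B"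
    using mem by (auto simp: bij_betw_def)
  then show ?thesis
    by (auto simp: \<sigma>_def intro!: exI[of _ \<sigma>])
qed

text \<open>
  A path has one edge fewer than vertices, and its edges are matched with its vertices in \<open>B\<close>.
\<close>

lemma matching_imp_partition_basis:
  assumes \<sigma>: "bij_betw \<sigma> R B" "\<And>X. X \<in> R \<Longrightarrow> \<sigma> X = s X \<or> \<sigma> X = t X"
  shows "partition_basis E conn B"
  unfolding partition_basis_def
proof (intro conjI ballI)
  show BE: "B \<subseteq> E"
  proof
    fix x assume "x \<in> B"
    then obtain X where X: "X \<in> R" "x = \<sigma> X"
      using \<sigma>(1) by (auto simp: bij_betw_def)
    then show "x \<in> E"
      using \<sigma>(2)[of X] sE[of X] tE[of X] by auto
  qed
  fix m assume m: "m \<in> E"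
  define K where "K = {j \<in> E. conn j m}"
  define S where "S = {X \<in> R. s X \<in> K}"
  have finK: "finite K"
    using finE by (simp add: K_def)
  have mK: "m \<in> K"
    using m conn_refl by (simp add: K_def)
  have tK: "t X \<in> K \<longleftrightarrow> s X \<in> K" for X
    using conn_edge[of X] conn_trans conn_sym sE tE unfolding K_def by blast
  have "Max (h ` K) \<in> h ` K"
    using finK mK by (intro Max_in) auto
  then obtain top where top: "top \<in> K" "\<And>j. j \<in> K \<Longrightarrow> h j \<le> h top"
    using Max_ge[OF finite_imageI[OF finK], of _ h] by auto
  have "bij_betw s S (K - {top})"
    unfolding bij_betw_def
  proof
    show "inj_on s S"
      using inj_s by (rule inj_on_subset) simp
    show "s ` S = K - {top}"
    proof
      show "s ` S \<subseteq> K - {top}"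
        using top(2) tK height unfolding S_def by (auto simp flip: not_less)
      show "K - {top} \<subseteq> s ` S"
      proof
        fix j assume j: "j \<in> K - {top}"
        then have "conn j top"
          using top(1) conn_trans conn_sym unfolding K_def by blast
        moreover have "\<not> reach top j"
          using reach_height[of top j] top(2)[of j] j by auto
        ultimately have "reach j top"
          by (simp add: conn_def)
        with j obtain X where X: "j = s X"
          unfolding reach_def by (auto elim: converse_rtranclpE)
        then show "j \<in> s ` S"
          using j sE unfolding S_def K_def by auto
      qed
    qed
  qed
  then have card_S: "card S = card (K - {top})"
    by (rule bij_betw_same_card)
  have "\<sigma> ` S = K \<inter> B"
  proof
    show "\<sigma> ` S \<subseteq> K \<inter> B"
      using \<sigma> tK unfolding S_def by (fastforce simp: bij_betw_def)
    show "K \<inter> B \<subseteq> \<sigma> ` S"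
    proof
      fix j assume "j \<in> K \<inter> B"
      moreover from this obtain X where "X \<in> R" "j = \<sigma> X"
        using \<sigma>(1) by (auto simp: bij_betw_def)
      ultimately show "j \<in> \<sigma> ` S"
        using \<sigma>(2)[of X] tK[of X] unfolding S_def by auto
    qed
  qed
  moreover have "inj_on \<sigma> S"
    using \<sigma>(1) by (rule inj_on_subset[OF bij_betw_imp_inj_on]) (simp add: S_def)
  ultimately have "card (K \<inter> B) = card S"
    by (metis card_image)
  then have "card (K \<inter> B) + 1 = card K"
    using card_S card_remove_plus_1[OF finK top(1)] by simp
  then have "card (K - B) = 1"
    using card_Int_Diff[OF finK, of B] by simp
  then obtain x where "K - B = {x}"
    by (auto simp: card_1_singleton_iff)
  moreover have "j \<in> E - B \<and> conn j m \<longleftrightarrow> j \<in> K - B" for j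
    by (auto simp: K_def)
  ultimately show "\<exists>!j. j \<in> E - B \<and> conn j m"
    by auto
qed

lemma matching_iff_partition_basis:
  "(\<exists>\<sigma>. bij_betw \<sigma> R B \<and> (\<forall>X\<in>R. \<sigma> X = s X \<or> \<sigma> X = t X)) \<longleftrightarrow> partition_basis E conn B"
  using partition_basis_imp_matching matching_imp_partition_basis by blast

lemma card_partition_basis: "partition_basis E conn B \<Longrightarrow> card B = card R"
  using partition_basis_imp_matching bij_betw_same_card by metis

end

end

section \<open>Homogeneous generators of a tropical ideal\<close>

lemma mdegree_add: "mdegree (m + n) = mdegree m + mdegree n"
  by (simp add: mdegree_def lookup_add sum.distrib)

lemma in_monomials_iff [simp]: "m \<in> monomials d \<longleftrightarrow> mdegree m = d"
  by (simp add: monomials_def)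

lemma finite_monomials: "finite (monomials d :: 'v::finite monomial set)"
proof (rule finite_imageD)
  have "lookup m i \<le> mdegree m" for m :: "'v monomial" and i
    unfolding mdegree_def by (rule member_le_sum) auto
  then have "lookup ` (monomials d :: 'v monomial set) \<subseteq> UNIV \<rightarrow>\<^sub>E {..d}"
    by (auto simp: PiE_UNIV_domain)
  then show "finite (lookup ` (monomials d :: 'v monomial set))"
    by (rule finite_subset) (auto intro: finite_PiE)
qed (rule inj_on_subset[OF poly_mapping.lookup_inject[THEN iffD1, THEN injI]], simp_all)

lemma lookup_hom_component: "lookup (hom_component d f) m = (if mdegree m = d then lookup f m else 0)"
proof -
  have "lookup (hom_component d f) m
      = (\<Sum>k\<in>keys f \<inter> monomials d. if k = m then lookup f k else 0)"
    by (simp add: hom_component_def lookup_sum lookup_single when_def)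
  also have "\<dots> = (if m \<in> keys f \<inter> monomials d then lookup f m else 0)"
    by (rule sum.delta) simp
  finally show ?thesis
    by (auto simp: in_keys_iff)
qed

lemma hom_component_add: "hom_component d (f + g) = hom_component d f + hom_component d g"
  by (rule poly_mapping_eqI) (simp add: lookup_hom_component lookup_add)

lemma hom_component_smult: "hom_component d (smult c f) = smult c (hom_component d f)"
  by (rule poly_mapping_eqI) (simp add: lookup_hom_component)

lemma hom_component_0 [simp]: "hom_component d 0 = 0"
  by (rule poly_mapping_eqI) (simp add: lookup_hom_component)

lemma hom_component_homogeneous:
  assumes "homogeneous_of e f"
  shows "hom_component d f = (if d = e then f else 0)"
  by (rule poly_mapping_eqI)
    (use assms in \<open>auto simp: lookup_hom_component homogeneous_of_def in_keys_iff subset_iff\<close>)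

lemma sum_hom_component: "(\<Sum>d\<in>mdegree ` keys f. hom_component d f) = f"
proof (rule poly_mapping_eqI)
  fix m
  have "lookup (\<Sum>d\<in>mdegree ` keys f. hom_component d f) m
      = (\<Sum>d\<in>mdegree ` keys f. if d = mdegree m then lookup f m else 0)"
    unfolding lookup_sum by (rule sum.cong) (auto simp: lookup_hom_component)
  also have "\<dots> = lookup f m"
    by (auto simp: sum.delta in_keys_iff)
  finally show "lookup (\<Sum>d\<in>mdegree ` keys f. hom_component d f) m = lookup f m" .
qed

lemma pdegree_homogeneous:
  assumes "keys f \<subseteq> monomials e" "keys f \<noteq> {}"
  shows "pdegree f = e"
proof -
  have "mdegree m = e" if "m \<in> keys f" for m
    using assms(1) that by auto
  with assms(2) have "mdegree ` keys f = {e}"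
    by blast
  then show ?thesis
    by (simp add: pdegree_def)
qed

lemma tropical_linear_space_0:
  assumes "finite E"
  shows "tropical_linear_space E {0}"
proof -
  have "valuated_matroid E 0 (\<lambda>_. 1)"
    using assms by (auto simp: valuated_matroid_def intro!: exI[of _ "{}"])
  moreover have "linear_space_of E 0 (\<lambda>_. 1) = {0}"
    by (simp add: linear_space_of_def trop_submodule_hull_empty)
  ultimately show ?thesis
    unfolding tropical_linear_space_def by metis
qed

lemma poly_mapping_sum_singles: "(\<Sum>m\<in>keys f. single m (lookup f m)) = f"
  by (rule poly_mapping_eqI)
    (simp add: lookup_sum lookup_single when_def sum.delta in_keys_iff)

lemma ideal_imp_trop_submodule:
  fixes J :: "('v, trop) polynomial set"
  assumes "is_ideal J"
  shows "trop_submodule J"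
  using assms by (simp add: is_ideal_def trop_submodule_def smult_eq_mult)

context
  fixes V :: "('v::finite, trop) polynomial set"
  assumes hom: "\<And>v. v \<in> V \<Longrightarrow> homogeneous v"
begin

lemma hom_component_hull:
  assumes "g \<in> trop_submodule hull V"
  shows "hom_component d g \<in> trop_submodule hull {v \<in> V. homogeneous_of d v}"
  using assms
proof (induction rule: trop_submodule_hull_induct)
  case (base v)
  then obtain e where "homogeneous_of e v"
    using hom by (auto simp: homogeneous_def)
  then show ?case
    using base by (auto simp: hom_component_homogeneous trop_submodule_hull_0 intro: hull_inc)
qed (auto simp: hom_component_add hom_component_smult
    intro: trop_submodule_hull_0 trop_submodule_hull_add trop_submodule_hull_smult)

lemma graded_part_hull:
  "graded_part (trop_submodule hull V) d = trop_submodule hull {v \<in> V. homogeneous_of d v}"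
proof
  show "graded_part (trop_submodule hull V) d \<subseteq> trop_submodule hull {v \<in> V. homogeneous_of d v}"
  proof
    fix g assume "g \<in> graded_part (trop_submodule hull V) d"
    then show "g \<in> trop_submodule hull {v \<in> V. homogeneous_of d v}"
      using hom_component_hull[of g d] hom_component_homogeneous[of d g d]
      by (simp add: graded_part_def)
  qed
  have "homogeneous_of d g" if "g \<in> trop_submodule hull {v \<in> V. homogeneous_of d v}" for g
    using that
  proof (induction rule: trop_submodule_hull_induct)
    case (add v w)
    then show ?case
      using keys_add[of v w] by (auto simp: homogeneous_of_def)
  qed (auto simp: homogeneous_of_def in_keys_iff subset_iff)
  moreover have "trop_submodule hull {v \<in> V. homogeneous_of d v} \<subseteq> trop_submodule hull V"
    by (rule hull_mono) auto
  ultimately show "trop_submodule hull {v \<in> V. homogeneous_of d v} \<subseteq> graded_part (trop_submodule hull V) d"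
    by (auto simp: graded_part_def)
qed

lemma graded_sum_hull:
  "graded_sum (\<lambda>d. trop_submodule hull {v \<in> V. homogeneous_of d v}) = trop_submodule hull V"
proof
  show "graded_sum (\<lambda>d. trop_submodule hull {v \<in> V. homogeneous_of d v}) \<subseteq> trop_submodule hull V"
  proof
    fix g assume g: "g \<in> graded_sum (\<lambda>d. trop_submodule hull {v \<in> V. homogeneous_of d v})"
    have "hom_component d g \<in> trop_submodule hull V" for d
      using g hull_mono[of "{v \<in> V. homogeneous_of d v}" V trop_submodule]
      by (auto simp: graded_sum_def)
    then have "(\<Sum>d\<in>mdegree ` keys g. hom_component d g) \<in> trop_submodule hull V"
      by (intro trop_submodule_sum trop_submodule_hull)
    then show "g \<in> trop_submodule hull V"
      by (simp add: sum_hom_component)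
  qed
qed (auto simp: graded_sum_def hom_component_hull)

lemma homogeneous_ideal_hull:
  assumes shift: "\<And>w v. v \<in> V \<Longrightarrow> single w 1 * v \<in> trop_submodule hull V"
  shows "homogeneous_ideal (trop_submodule hull V)"
  unfolding homogeneous_ideal_def is_ideal_def
proof (intro conjI ballI allI)
  have shift: "single w 1 * g \<in> trop_submodule hull V" if "g \<in> trop_submodule hull V" for w g
    using that
  proof (induction rule: trop_submodule_hull_induct)
    case (smult c g)
    have "single w 1 * smult c g = smult c (single w 1 * g)"
      by (simp add: smult_eq_mult mult.left_commute)
    then show ?case
      using smult by (simp add: trop_submodule_hull_smult)
  qed (auto simp: distrib_left intro: shift trop_submodule_hull_0 trop_submodule_hull_add)
  fix c g assume g: "g \<in> trop_submodule hull V"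
  have "c * g = (\<Sum>m\<in>keys c. single m (lookup c m)) * g"
    by (simp add: poly_mapping_sum_singles)
  also have "\<dots> = (\<Sum>m\<in>keys c. smult (lookup c m) (single m 1 * g))"
    by (simp add: sum_distrib_right smult_eq_mult mult_single flip: mult.assoc)
  also have "\<dots> \<in> trop_submodule hull V"
    by (intro trop_submodule_sum trop_submodule_hull trop_submodule_hull_smult shift g)
  finally show "c * g \<in> trop_submodule hull V" .
next
  fix g d assume "g \<in> trop_submodule hull V"
  then show "hom_component d g \<in> trop_submodule hull V"
    using hom_component_hull[of g d] hull_mono[of "{v \<in> V. homogeneous_of d v}" V trop_submodule]
    by auto
qed (auto intro: trop_submodule_hull_0 trop_submodule_hull_add)

text \<open>
  The generators span the Macaulay ideal and lie in every tropical ideal that contains \<open>f\<close>, so the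
  Macaulay ideal is the least such ideal. A least element is the only minimal one.
\<close>

lemma tropically_principal_iff_macaulay:
  assumes shift: "\<And>w v. v \<in> V \<Longrightarrow> single w 1 * v \<in> trop_submodule hull V"
    and part: "\<And>d. macaulay_part f d = trop_submodule hull {v \<in> V. homogeneous_of d v}"
    and linear: "\<And>d. tropical_linear_space (monomials d) (macaulay_part f d)"
    and f: "f \<in> trop_submodule hull V"
    and least: "\<And>J. tropical_ideal J \<Longrightarrow> f \<in> J \<Longrightarrow> V \<subseteq> J"
  shows "tropically_principal f J \<longleftrightarrow> J = macaulay_ideal f"
proof -
  have eq: "macaulay_ideal f = trop_submodule hull V"
    unfolding macaulay_ideal_def part[abs_def] graded_sum_hull ..
  have ideal: "tropical_ideal (macaulay_ideal f)"
    unfolding tropical_ideal_def eq graded_part_hull part[symmetric]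
    using homogeneous_ideal_hull[OF shift] linear by blast
  have least': "macaulay_ideal f \<subseteq> J" if "tropical_ideal J" "f \<in> J" for J
    unfolding eq
  proof (rule hull_minimal)
    show "V \<subseteq> J"
      using that by (rule least)
    show "trop_submodule J"
      using that by (auto simp: tropical_ideal_def homogeneous_ideal_def ideal_imp_trop_submodule)
  qed
  show ?thesis
    unfolding tropically_principal_def using ideal least' f eq by blast
qed

text \<open>
  A factor \<open>c\<close> is allowed in the lifting condition because the norm need not attain the
  coefficients of a generator. The condition on keys keeps the lift in the same degree.
\<close>

lemma macaulay_ideal_eq_trop_ideal:
  assumes part: "\<And>d. macaulay_part f d = trop_submodule hull {v \<in> V. homogeneous_of d v}"
    and lift: "\<And>v. v \<in> V \<Longrightarrow> \<exists>G\<in>I. keys G \<subseteq> keys v \<and> (\<exists>c. v = smult c (trop_poly \<nu> G))"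
    and proj: "\<And>G. G \<in> I \<Longrightarrow> trop_poly \<nu> G \<in> trop_submodule hull V"
  shows "macaulay_ideal f = trop_ideal \<nu> I"
proof -
  have "macaulay_part f d = trop_submodule hull (trop_poly \<nu> ` graded_part I d)" for d
  proof
    show "macaulay_part f d \<subseteq> trop_submodule hull (trop_poly \<nu> ` graded_part I d)"
      unfolding part
    proof (rule hull_minimal, safe)
      fix v assume v: "v \<in> V" "homogeneous_of d v"
      then obtain G c where G: "G \<in> I" "keys G \<subseteq> keys v" "v = smult c (trop_poly \<nu> G)"
        using lift by blast
      then have "G \<in> graded_part I d"
        using v by (auto simp: graded_part_def homogeneous_of_def)
      then show "v \<in> trop_submodule hull (trop_poly \<nu> ` graded_part I d)"
        unfolding G(3) by (intro trop_submodule_hull_smult hull_inc imageI)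
    qed (rule trop_submodule_hull)
    show "trop_submodule hull (trop_poly \<nu> ` graded_part I d) \<subseteq> macaulay_part f d"
    proof (rule hull_minimal)
      show "trop_poly \<nu> ` graded_part I d \<subseteq> macaulay_part f d"
      proof safe
        fix G assume G: "G \<in> graded_part I d"
        have "keys (trop_poly \<nu> G) \<subseteq> keys G"
          by (auto simp: trop_poly_def in_keys_iff Poly_Mapping.map.rep_eq when_def)
        then have "trop_poly \<nu> G \<in> graded_part (trop_submodule hull V) d"
          using G proj by (auto simp: graded_part_def homogeneous_of_def)
        then show "trop_poly \<nu> G \<in> macaulay_part f d"
          unfolding part graded_part_hull .
      qed
      show "trop_submodule (macaulay_part f d)"
        unfolding part by (rule trop_submodule_hull)
    qed
  qed
  then show ?thesis
    unfolding macaulay_ideal_def trop_ideal_def by presburger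
qed

end

section \<open>Norms and principal ideals\<close>

lemma nonarch_norm_eq_0_iff: "nonarch_norm \<nu> \<Longrightarrow> \<nu> x = 0 \<longleftrightarrow> x = 0"
  and nonarch_norm_mult: "nonarch_norm \<nu> \<Longrightarrow> \<nu> (x * y) = \<nu> x * \<nu> y"
  and nonarch_norm_minus_1: "nonarch_norm \<nu> \<Longrightarrow> \<nu> (- 1) = 1"
  and nonarch_norm_add: "nonarch_norm \<nu> \<Longrightarrow> \<nu> (x + y) \<le> max (\<nu> x) (\<nu> y)"
  by (simp_all add: nonarch_norm_def)

lemma nonarch_norm_minus:
  assumes "nonarch_norm \<nu>"
  shows "\<nu> (- x) = \<nu> x"
  using nonarch_norm_mult[OF assms, of "- 1" x] nonarch_norm_minus_1[OF assms] by simp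

lemma nonarch_norm_add_dominant:
  assumes \<nu>: "nonarch_norm \<nu>" and less: "\<nu> y < \<nu> x"
  shows "\<nu> (x + y) = \<nu> x"
proof (rule order.antisym)
  show "\<nu> (x + y) \<le> \<nu> x"
    using nonarch_norm_add[OF \<nu>, of x y] less by simp
  show "\<nu> x \<le> \<nu> (x + y)"
    using nonarch_norm_add[OF \<nu>, of "x + y" "- y"] less nonarch_norm_minus[OF \<nu>]
    by (auto simp: le_max_iff_disj)
qed

lemma lookup_trop_poly:
  assumes "nonarch_norm \<nu>"
  shows "lookup (trop_poly \<nu> F) m = \<nu> (lookup F m)"
  using nonarch_norm_eq_0_iff[OF assms] by (simp add: trop_poly_def Poly_Mapping.map.rep_eq when_def)

lemma keys_trop_poly:
  assumes "nonarch_norm \<nu>"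
  shows "keys (trop_poly \<nu> F) = keys F"
  by (rule set_eqI) (simp add: in_keys_iff lookup_trop_poly[OF assms] nonarch_norm_eq_0_iff[OF assms])

lemma is_ideal_hull_singleton:
  "is_ideal hull {F} = range (\<lambda>H. H * (F :: 'a::comm_semiring_1))"
proof (rule hull_unique)
  show "{F} \<subseteq> range (\<lambda>H. H * F)"
    using rangeI[of "\<lambda>H. H * F" 1] by simp
  show "is_ideal (range (\<lambda>H. H * F))"
    unfolding is_ideal_def
  proof (intro conjI ballI allI)
    show "0 \<in> range (\<lambda>H. H * F)"
      using rangeI[of "\<lambda>H. H * F" 0] by simp
  next
    fix a b assume "a \<in> range (\<lambda>H. H * F)" "b \<in> range (\<lambda>H. H * F)"
    then show "a + b \<in> range (\<lambda>H. H * F)"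
      by (auto simp flip: distrib_right)
  next
    fix c a assume "a \<in> range (\<lambda>H. H * F)"
    then show "c * a \<in> range (\<lambda>H. H * F)"
      by (auto simp flip: mult.assoc)
  qed
  show "range (\<lambda>H. H * F) \<subseteq> T" if "{F} \<subseteq> T" "is_ideal T" for T
    using that by (auto simp: is_ideal_def)
qed

lemma lookup_mult_single:
  fixes u :: "'v::finite monomial" and c :: "'a::comm_semiring_1"
  shows "lookup (H * single u c) m = (\<Sum>w\<in>keys H. if w + u = m then lookup H w * c else 0)"
proof -
  have "H * single u c = (\<Sum>w\<in>keys H. single w (lookup H w)) * single u c"
    by (simp add: poly_mapping_sum_singles)
  also have "\<dots> = (\<Sum>w\<in>keys H. single (w + u) (lookup H w * c))"
    by (simp add: sum_distrib_right mult_single)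
  finally show ?thesis
    by (simp add: lookup_sum lookup_single when_def)
qed

lemma lookup_mult_single_add:
  fixes u :: "'v::finite monomial" and c :: "'a::comm_semiring_1"
  shows "lookup (H * single u c) (w + u) = lookup H w * c"
  by (auto simp: lookup_mult_single in_keys_iff)

lemma lookup_mult_single_eq_0:
  fixes u :: "'v::finite monomial" and c :: "'a::comm_semiring_1"
  assumes "\<And>w. m \<noteq> w + u"
  shows "lookup (H * single u c) m = 0"
  unfolding lookup_mult_single using assms by (intro sum.neutral) auto


section \<open>Monomials\<close>

lemma valuated_matroid_unique_basis:
  assumes "finite E" "S \<subseteq> E" "c \<noteq> 0"
  shows "valuated_matroid E (card S) (\<lambda>B. if B = S then c else 0)"
  unfolding valuated_matroid_def tropically_vanishes_def
proof (intro conjI allI impI ballI)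
  fix A C j
  let ?g = "\<lambda>i. (if A - {i} = S then c else 0) * (if insert i C = S then c else 0)"
  have "?g i = 0" for i
    by auto
  then show "sum ?g (A - C - {j}) = sum ?g (A - C)"
    by (simp only: sum.neutral_const)
qed (use assms in auto)

lemma linear_space_of_unique_basis:
  assumes fin: "finite E" and S: "S \<subseteq> E" and c: "c \<noteq> 0"
  shows "linear_space_of E (card S) (\<lambda>B. if B = S then c else 0)
    = trop_submodule hull ((\<lambda>i. single i 1) ` S)" (is "linear_space_of E _ ?p = _")
proof
  have finS: "finite S"
    using S fin by (rule finite_subset)
  have cocircuit: "cocircuit E ?p (S - {i}) = smult c (single i 1)" if "i \<in> S" for i
    by (rule poly_mapping_eqI) (use that S in \<open>auto simp: lookup_cocircuit[OF fin] lookup_single when_def\<close>)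
  show "linear_space_of E (card S) ?p \<subseteq> trop_submodule hull ((\<lambda>i. single i 1) ` S)"
    unfolding linear_space_of_def
  proof (rule hull_minimal, safe)
    fix C assume "C \<subseteq> E" "card C + 1 = card S"
    show "cocircuit E ?p C \<in> trop_submodule hull ((\<lambda>i. single i 1) ` S)"
    proof (cases "\<exists>i. i \<notin> C \<and> insert i C = S")
      case True
      then obtain i where "i \<in> S" "C = S - {i}"
        by blast
      then show ?thesis
        by (simp add: cocircuit trop_submodule_hull_smult hull_inc)
    next
      case False
      then have "cocircuit E ?p C = 0"
        by (intro poly_mapping_eqI) (auto simp: lookup_cocircuit[OF fin])
      then show ?thesis
        by (simp add: trop_submodule_hull_0)
    qed
  qed (rule trop_submodule_hull)
  obtain d where d: "d * c = 1"
    using trop_inverse[OF c] by blast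
  have "single i 1 \<in> linear_space_of E (card S) ?p" if i: "i \<in> S" for i
  proof -
    have "smult d (cocircuit E ?p (S - {i})) \<in> linear_space_of E (card S) ?p"
      by (rule smult_cocircuit_in_linear_space_of) (use S card_remove_plus_1[OF finS i] in auto)
    then show ?thesis
      by (simp add: cocircuit[OF i] d)
  qed
  then have "(\<lambda>i. single i 1) ` S \<subseteq> linear_space_of E (card S) ?p"
    by blast
  then show "trop_submodule hull ((\<lambda>i. single i 1) ` S) \<subseteq> linear_space_of E (card S) ?p"
    by (rule hull_minimal) (simp add: linear_space_of_def)
qed

context
  fixes u :: "'v::finite monomial" and a :: trop
  assumes a: "a \<noteq> 0"
begin

definition monomial_multiples :: "('v, trop) polynomial set"
  where "monomial_multiples = range (\<lambda>w. single (w + u) 1)"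

lemma homogeneous_monomial_multiples: "g \<in> monomial_multiples \<Longrightarrow> homogeneous g"
  by (auto simp: monomial_multiples_def homogeneous_def homogeneous_of_def)

lemma maximal_minor_monomial:
  assumes "finite R"
  shows "maximal_minor (macaulay_matrix (single u a)) R
    = (\<lambda>B. if B = (\<lambda>w. w + u) ` R then a ^ card R else 0)"
proof
  fix B
  have "maximal_minor (macaulay_matrix (single u a)) R B =
      (if \<exists>\<sigma>. bij_betw \<sigma> R B \<and> (\<forall>w\<in>R. \<sigma> w = w + u) then (\<Prod>w\<in>R. a) * (\<Prod>m\<in>B. 1) else 0)"
    by (rule maximal_minor_rescaled[OF assms])
      (auto simp: macaulay_matrix_def mult_single lookup_single when_def)
  moreover have "(\<exists>\<sigma>. bij_betw \<sigma> R B \<and> (\<forall>w\<in>R. \<sigma> w = w + u)) \<longleftrightarrow> B = (\<lambda>w. w + u) ` R"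
  proof
    assume "\<exists>\<sigma>. bij_betw \<sigma> R B \<and> (\<forall>w\<in>R. \<sigma> w = w + u)"
    then show "B = (\<lambda>w. w + u) ` R"
      by (auto simp: bij_betw_def)
  next
    assume "B = (\<lambda>w. w + u) ` R"
    then show "\<exists>\<sigma>. bij_betw \<sigma> R B \<and> (\<forall>w\<in>R. \<sigma> w = w + u)"
      by (intro exI[of _ "\<lambda>w. w + u"]) (auto simp: bij_betw_def inj_on_def)
  qed
  ultimately show "maximal_minor (macaulay_matrix (single u a)) R B
      = (if B = (\<lambda>w. w + u) ` R then a ^ card R else 0)"
    by simp
qed

lemma macaulay_part_monomial:
  shows "macaulay_part (single u a) d
      = trop_submodule hull {g \<in> monomial_multiples. homogeneous_of d g}"
    and "tropical_linear_space (monomials d) (macaulay_part (single u a) d)"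
proof -
  let ?V = "{g \<in> monomial_multiples. homogeneous_of d g}"
  have V: "?V = (\<lambda>i. single i 1) ` {w + u | w. mdegree w + mdegree u = d}"
    by (auto simp: monomial_multiples_def homogeneous_of_def mdegree_add)
  have deg: "pdegree (single u a) = mdegree u"
    by (rule pdegree_homogeneous) (use a in auto)
  have "macaulay_part (single u a) d = trop_submodule hull ?V \<and>
    tropical_linear_space (monomials d) (macaulay_part (single u a) d)"
  proof (cases "d < mdegree u")
    case True
    then have "?V = {}"
      unfolding V by auto
    moreover have "macaulay_part (single u a) d = {0}"
      using True by (simp add: macaulay_part_def deg)
    ultimately show ?thesis
      by (simp only: trop_submodule_hull_empty tropical_linear_space_0[OF finite_monomials] simp_thms)
  next
    case False
    define R :: "'v monomial set" where "R = monomials (d - mdegree u)"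
    define S where "S = (\<lambda>w. w + u) ` R"
    have finR: "finite R"
      unfolding R_def by (rule finite_monomials)
    have S: "S = {w + u | w. mdegree w + mdegree u = d}"
      using False by (auto simp: S_def R_def)
    have SE: "S \<subseteq> monomials d"
      by (auto simp: S mdegree_add)
    have card: "card S = card R"
      unfolding S_def by (rule card_image) (auto simp: inj_on_def)
    have nz: "a ^ card R \<noteq> 0"
      using a by simp
    have part: "macaulay_part (single u a) d
        = linear_space_of (monomials d) (card S) (\<lambda>B. if B = S then a ^ card R else 0)"
      using False maximal_minor_monomial[OF finR]
      by (simp add: macaulay_part_def deg Let_def card flip: R_def S_def)
    have "?V = (\<lambda>i. single i 1) ` S"
      by (simp only: V S)
    then have "macaulay_part (single u a) d = trop_submodule hull ?V"
      by (simp only: part linear_space_of_unique_basis[OF finite_monomials SE nz])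
    moreover have "tropical_linear_space (monomials d) (macaulay_part (single u a) d)"
      unfolding part tropical_linear_space_def
      using valuated_matroid_unique_basis[OF finite_monomials SE nz] by blast
    ultimately show ?thesis ..
  qed
  then show "macaulay_part (single u a) d = trop_submodule hull ?V"
    "tropical_linear_space (monomials d) (macaulay_part (single u a) d)"
    by blast+
qed

lemma tropically_principal_monomial:
  "tropically_principal (single u a) J \<longleftrightarrow> J = macaulay_ideal (single u a)"
proof (rule tropically_principal_iff_macaulay[OF homogeneous_monomial_multiples])
  fix w g assume "g \<in> monomial_multiples"
  then obtain x where "g = single (x + u) 1"
    by (auto simp: monomial_multiples_def)
  then have "single w 1 * g = single (w + x + u) 1"
    by (simp add: mult_single add.assoc)
  then have "single w 1 * g \<in> monomial_multiples"
    by (auto simp: monomial_multiples_def)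
  then show "single w 1 * g \<in> trop_submodule hull monomial_multiples"
    by (rule hull_inc)
next
  have "single u a = smult a (single (0 + u) 1)"
    by (simp add: smult_single)
  also have "\<dots> \<in> trop_submodule hull monomial_multiples"
    unfolding monomial_multiples_def by (intro trop_submodule_hull_smult hull_inc rangeI)
  finally show "single u a \<in> trop_submodule hull monomial_multiples" .
next
  fix J :: "('v, trop) polynomial set"
  assume J: "tropical_ideal J" "single u a \<in> J"
  obtain b where b: "b * a = 1"
    using trop_inverse[OF a] by blast
  show "monomial_multiples \<subseteq> J"
  proof
    fix g assume "g \<in> monomial_multiples"
    then obtain w where "g = single (w + u) 1"
      by (auto simp: monomial_multiples_def)
    then have "g = single w b * single u a"
      by (simp add: mult_single b)
    then show "g \<in> J"
      using J by (auto simp: tropical_ideal_def homogeneous_ideal_def is_ideal_def)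
  qed
qed (assumption | rule macaulay_part_monomial)+

lemma macaulay_ideal_monomial_realizable:
  assumes \<nu>: "nonarch_norm (\<nu> :: 'k::field \<Rightarrow> trop)" and A: "\<nu> A = a"
  shows "macaulay_ideal (single u a) = trop_ideal \<nu> (is_ideal hull {single u A})"
proof (rule macaulay_ideal_eq_trop_ideal[OF homogeneous_monomial_multiples])
  fix g assume "g \<in> monomial_multiples"
  then obtain w where g: "g = single (w + u) 1"
    by (auto simp: monomial_multiples_def)
  obtain b where b: "b * a = 1"
    using trop_inverse[OF a] by blast
  have "trop_poly \<nu> (single w 1 * single u A) = single (w + u) a"
    by (rule poly_mapping_eqI)
      (use nonarch_norm_eq_0_iff[OF \<nu>] in \<open>auto simp: lookup_trop_poly[OF \<nu>] mult_single lookup_single when_def A\<close>)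
  then have "g = smult b (trop_poly \<nu> (single w 1 * single u A))"
    by (simp add: g smult_single b)
  moreover have "keys (single w 1 * single u A) \<subseteq> keys g"
    by (simp add: g mult_single)
  ultimately show "\<exists>G\<in>is_ideal hull {single u A}. keys G \<subseteq> keys g \<and> (\<exists>c. g = smult c (trop_poly \<nu> G))"
    unfolding is_ideal_hull_singleton by blast
next
  fix G assume "G \<in> is_ideal hull {single u A}"
  then obtain H where G: "G = H * single u A"
    by (auto simp: is_ideal_hull_singleton)
  have "trop_poly \<nu> G = (\<Sum>m\<in>keys (trop_poly \<nu> G). smult (lookup (trop_poly \<nu> G) m) (single m 1))"
    by (simp add: smult_single poly_mapping_sum_singles)
  also have "\<dots> \<in> trop_submodule hull monomial_multiples"
  proof (intro trop_submodule_sum trop_submodule_hull trop_submodule_hull_smult hull_inc)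
    fix m assume "m \<in> keys (trop_poly \<nu> G)"
    then have "lookup (H * single u A) m \<noteq> 0"
      by (simp add: keys_trop_poly[OF \<nu>] G in_keys_iff)
    then obtain w where "m = w + u"
      using lookup_mult_single_eq_0 by blast
    then show "single m 1 \<in> monomial_multiples"
      by (auto simp: monomial_multiples_def)
  qed
  finally show "trop_poly \<nu> G \<in> trop_submodule hull monomial_multiples" .
qed (assumption | rule macaulay_part_monomial)+

end

section \<open>Binomials\<close>

lemma trop_root:
  fixes c :: trop
  assumes "c \<noteq> 0" "k > 0"
  obtains z where "z ^ k = c" "z \<noteq> 0"
proof -
  have Rep_power: "Rep_trop (z ^ n) = Rep_trop z ^ n" for z n
    by (induction n) (simp_all add: one_trop.rep_eq times_trop.rep_eq)
  have nonneg: "0 \<le> Rep_trop c"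
    using Rep_trop[of c] by simp
  define z where "z = Abs_trop (root k (Rep_trop c))"
  have "Rep_trop z = root k (Rep_trop c)"
    unfolding z_def using nonneg assms(2) by (intro Abs_trop_inverse) simp
  then have "Rep_trop (z ^ k) = Rep_trop c"
    using nonneg assms(2) by (simp add: Rep_power)
  then have "z ^ k = c"
    by (simp add: Rep_trop_inject)
  moreover from this have "z \<noteq> 0"
    using assms by (auto simp: power_0_left)
  ultimately show ?thesis
    using that by blast
qed

lemma exists_smaller_exponent:
  assumes deg: "mdegree u = mdegree v" and neq: "u \<noteq> v"
  shows "\<exists>x. lookup u x < lookup v x"
proof (rule ccontr)
  assume "\<not> ?thesis"
  then have le: "\<And>x. lookup v x \<le> lookup u x"
    by (simp add: not_less)
  have "lookup v x = lookup u x" for x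
    by (rule sum_mono_inv[of "lookup v" UNIV "lookup u" x]) (use deg le in \<open>auto simp: mdegree_def\<close>)
  then show False
    using neq by (auto intro: poly_mapping_eqI)
qed

text \<open>
  Rescaling one variable makes the two coefficients equal. The exponents of some variable \<open>x\<close>
  differ, and \<open>\<phi>\<close> is a power of \<open>z\<close> with exponent the degree in \<open>x\<close>, where \<open>z\<close> is a root of
  \<open>b / a\<close>.
\<close>

lemma balancing_potential:
  fixes a b :: trop
  assumes "mdegree u = mdegree v" "u \<noteq> v" "a \<noteq> 0" "b \<noteq> 0"
  shows "\<exists>\<phi>. (\<forall>m. \<phi> m \<noteq> 0) \<and> (\<forall>m n. \<phi> (m + n) = \<phi> m * \<phi> n) \<and> a * \<phi> v = b * \<phi> u"
proof -
  obtain x where x: "lookup u x < lookup v x"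
    using exists_smaller_exponent[OF assms(1,2)] by blast
  obtain c where c: "c * a = 1" "c \<noteq> 0"
    using trop_inverse[OF assms(3)] by blast
  have "c * b \<noteq> 0" "0 < lookup v x - lookup u x"
    using c assms x by auto
  then obtain z where z: "z ^ (lookup v x - lookup u x) = c * b" "z \<noteq> 0"
    by (rule trop_root)
  have "lookup v x = (lookup v x - lookup u x) + lookup u x"
    using x by simp
  then have "a * z ^ lookup v x = a * (c * b * z ^ lookup u x)"
    by (metis power_add z(1))
  also have "\<dots> = c * a * (b * z ^ lookup u x)"
    by (simp add: mult_ac)
  finally have "a * z ^ lookup v x = b * z ^ lookup u x"
    by (simp add: c)
  then show ?thesis
    using z(2) by (intro exI[of _ "\<lambda>m. z ^ lookup m x"]) (simp add: lookup_add power_add)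
qed

locale balanced_binomial =
  fixes u v :: "'v::finite monomial" and a b :: trop and \<phi> :: "'v monomial \<Rightarrow> trop"
  assumes deg: "mdegree u = mdegree v" and neq: "u \<noteq> v"
    and a: "a \<noteq> 0" and b: "b \<noteq> 0"
    and \<phi>_nz: "\<phi> m \<noteq> 0" and \<phi>_add: "\<phi> (m + n) = \<phi> m * \<phi> n"
    and balance: "a * \<phi> v = b * \<phi> u"
begin

text \<open>
  Exchanging the two terms reverses all paths, so that an argument that moves forward along a
  path also applies backward.
\<close>

lemma swap: "balanced_binomial v u b a \<phi>"
  using deg neq a b \<phi>_nz \<phi>_add balance by unfold_locales auto

sublocale path_forest "\<lambda>w. w + u" "\<lambda>w. w + v"
  "\<lambda>m. lookup m (SOME x. lookup u x < lookup v x)"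
  by unfold_locales
    (use someI_ex[OF exists_smaller_exponent[OF deg neq]] in \<open>auto simp: inj_def lookup_add\<close>)

abbreviation f :: "('v, trop) polynomial"
  where "f \<equiv> single u a + single v b"

definition pair :: "'v monomial \<Rightarrow> 'v monomial \<Rightarrow> ('v, trop) polynomial"
  where "pair i j = single i (\<phi> i) + single j (\<phi> j)"

definition pairs :: "('v, trop) polynomial set"
  where "pairs = {pair i j | i j. i \<noteq> j \<and> conn i j}"

lemma pair_commute: "pair i j = pair j i"
  by (simp add: pair_def add.commute)

lemma lookup_pair:
  "i \<noteq> j \<Longrightarrow> lookup (pair i j) m = (if m = i then \<phi> i else if m = j then \<phi> j else 0)"
  by (simp add: pair_def lookup_add lookup_single when_def)

lemma keys_pair: "i \<noteq> j \<Longrightarrow> keys (pair i j) = {i, j}"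
  by (auto simp: in_keys_iff lookup_pair \<phi>_nz split: if_splits)

lemma conn_mdegree: "conn i j \<Longrightarrow> mdegree i = mdegree j"
proof -
  have "reach i j \<Longrightarrow> mdegree i = mdegree j" for i j
    by (induction rule: reach_induct) (simp_all add: mdegree_add deg)
  then show "conn i j \<Longrightarrow> ?thesis"
    by (auto simp: conn_def)
qed

text \<open>
  The two entries in the row \<open>w\<close> of the Macaulay matrix are one constant \<open>\<kappa>\<close> times the values of the
  potential at the ends of the edge.
\<close>

lemma edge_weight:
  obtains \<kappa> where "\<kappa> \<noteq> 0" "a = \<kappa> * \<phi> (w + u)" "b = \<kappa> * \<phi> (w + v)"
proof -
  obtain c where c: "c * \<phi> (w + u) = 1" "c \<noteq> 0"
    using trop_inverse[OF \<phi>_nz] by blast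
  have "\<phi> u * (a * c * \<phi> (w + v)) = c * (\<phi> w * \<phi> u) * (a * \<phi> v)"
    by (simp add: \<phi>_add mult_ac)
  also have "\<dots> = \<phi> u * b"
    using c(1) by (simp add: \<phi>_add balance mult_ac)
  finally have "a * c * \<phi> (w + v) = b"
    using mult_cancel_trop[OF \<phi>_nz] by blast
  moreover have "a * c * \<phi> (w + u) = a"
    using c(1) by (simp add: mult.assoc)
  ultimately show ?thesis
    using that[of "a * c"] a c(2) by simp
qed

lemma shift_f: "single w 1 * f = single (w + u) a + single (w + v) b"
  by (simp add: distrib_left mult_single)

lemma edge_eq: "\<exists>c. pair (w + u) (w + v) = smult c (single w 1 * f)"
  and shift_f_eq: "\<exists>\<kappa>. single w 1 * f = smult \<kappa> (pair (w + u) (w + v))"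
proof -
  obtain \<kappa> where \<kappa>: "\<kappa> \<noteq> 0" "a = \<kappa> * \<phi> (w + u)" "b = \<kappa> * \<phi> (w + v)"
    by (rule edge_weight)
  then have eq: "single w 1 * f = smult \<kappa> (pair (w + u) (w + v))"
    unfolding shift_f by (simp add: pair_def smult_add smult_single flip: \<kappa>(2,3))
  obtain c where "c * \<kappa> = 1"
    using trop_inverse[OF \<kappa>(1)] by blast
  with eq have "pair (w + u) (w + v) = smult c (single w 1 * f)"
    by simp
  with eq show "\<exists>c. pair (w + u) (w + v) = smult c (single w 1 * f)"
    "\<exists>\<kappa>. single w 1 * f = smult \<kappa> (pair (w + u) (w + v))"
    by blast+
qed

lemma homogeneous_pairs: "g \<in> pairs \<Longrightarrow> homogeneous g"
  using conn_mdegree by (auto simp: pairs_def homogeneous_def homogeneous_of_def keys_pair)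

lemma pairs_homogeneous_of:
  "{g \<in> pairs. homogeneous_of d g}
    = {single i (\<phi> i) + single j (\<phi> j) | i j. i \<in> monomials d \<and> j \<in> monomials d \<and> i \<noteq> j \<and> conn i j}"
proof -
  have "homogeneous_of d (pair i j) \<longleftrightarrow> i \<in> monomials d \<and> j \<in> monomials d" if "i \<noteq> j" for i j
    using keys_pair[OF that] by (simp add: homogeneous_of_def)
  then show ?thesis
    unfolding pairs_def pair_def[symmetric] by blast
qed

lemma macaulay_part_binomial:
  shows "macaulay_part f d = trop_submodule hull {g \<in> pairs. homogeneous_of d g}"
    and "tropical_linear_space (monomials d) (macaulay_part f d)"
proof -
  have keys: "keys f = {u, v}"
    using neq a b by (auto simp: in_keys_iff lookup_add lookup_single when_def split: if_splits)
  have pdeg: "pdegree f = mdegree u"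
    by (rule pdegree_homogeneous) (use keys deg in auto)
  have "macaulay_part f d = trop_submodule hull {g \<in> pairs. homogeneous_of d g} \<and>
    tropical_linear_space (monomials d) (macaulay_part f d)"
  proof (cases "d < mdegree u")
    case True
    have "\<not> conn i j" if "mdegree i = d" "i \<noteq> j" for i j
    proof -
      have low: "i = j" if "reach i j" "mdegree i < mdegree u" for i j
        using that by (induction rule: reach_induct) (auto simp: mdegree_add)
      then show ?thesis
        using that True conn_mdegree[of i j] low[of i j] low[of j i] unfolding conn_def by metis
    qed
    then have "{g \<in> pairs. homogeneous_of d g} = {}"
      unfolding pairs_homogeneous_of by auto
    moreover have "macaulay_part f d = {0}"
      using True by (simp add: macaulay_part_def pdeg)
    ultimately show ?thesis
      by (simp only: trop_submodule_hull_empty tropical_linear_space_0[OF finite_monomials] simp_thms)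
  next
    case False
    define R :: "'v monomial set" where "R = monomials (d - mdegree u)"
    have finR: "finite R"
      unfolding R_def by (rule finite_monomials)
    have sR: "\<And>w. w + u \<in> monomials d \<longleftrightarrow> w \<in> R" and tR: "\<And>w. w + v \<in> monomials d \<longleftrightarrow> w \<in> R"
      using False deg by (auto simp: R_def mdegree_add)
    have "\<exists>\<kappa>. \<kappa> \<noteq> 0 \<and> a = \<kappa> * \<phi> (w + u) \<and> b = \<kappa> * \<phi> (w + v)" for w
      using edge_weight by metis
    then obtain \<kappa> where \<kappa>: "\<And>w. \<kappa> w \<noteq> 0" "\<And>w. a = \<kappa> w * \<phi> (w + u)" "\<And>w. b = \<kappa> w * \<phi> (w + v)"
      by metis
    define p where "p = maximal_minor (macaulay_matrix f) R"
    have p: "p B = (if partition_basis (monomials d) conn B then prod \<kappa> R * prod \<phi> B else 0)" for B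
    proof -
      have "macaulay_matrix f X Y = (if Y = X + u \<or> Y = X + v then \<kappa> X * \<phi> Y else 0)" for X Y
        using neq by (auto simp: macaulay_matrix_def shift_f lookup_add lookup_single when_def
            simp flip: \<kappa>(2,3))
      then show ?thesis
        unfolding p_def
        using maximal_minor_rescaled[OF finR, of "macaulay_matrix f" "\<lambda>X Y. Y = X + u \<or> Y = X + v" \<kappa> \<phi> B]
          matching_iff_partition_basis[OF finite_monomials sR tR, of B]
        by simp
    qed
    have nz: "prod \<kappa> R \<noteq> 0"
      using \<kappa>(1) by (intro prod_trop_nonzero)
    have part: "macaulay_part f d = linear_space_of (monomials d) (card R) p"
      using False by (simp add: macaulay_part_def pdeg Let_def p_def flip: R_def)
    note partition = finite_monomials equivp_conn p nz \<phi>_nz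
      card_partition_basis[OF finite_monomials sR tR]
    have "valuated_matroid (monomials d) (card R) p"
      by (rule valuated_matroid_partition[OF partition])
    then show ?thesis
      unfolding part tropical_linear_space_def pairs_homogeneous_of
      using linear_space_of_partition[OF partition] by blast
  qed
  then show "macaulay_part f d = trop_submodule hull {g \<in> pairs. homogeneous_of d g}"
    "tropical_linear_space (monomials d) (macaulay_part f d)"
    by blast+
qed

text \<open>
  Translation by \<open>w\<close> maps edges to edges and multiplies \<open>\<phi>\<close> by \<open>\<phi> w\<close>.
\<close>

lemma shift_pairs:
  assumes "g \<in> pairs"
  shows "single w 1 * g \<in> trop_submodule hull pairs"
proof -
  obtain i j where ij: "g = pair i j" "i \<noteq> j" "conn i j"
    using assms by (auto simp: pairs_def)
  obtain c where c: "c * \<phi> w = 1"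
    using trop_inverse[OF \<phi>_nz] by blast
  have "conn (w + i) (w + j)"
    using ij(3) by (rule conn_map) (metis add.assoc)
  moreover have "w + i \<noteq> w + j"
    using ij(2) by simp
  ultimately have "pair (w + i) (w + j) \<in> pairs"
    unfolding pairs_def by blast
  moreover have "smult c (pair (w + i) (w + j)) = single w 1 * g"
    using c by (simp add: ij(1) pair_def \<phi>_add smult_add smult_single distrib_left mult_single
        flip: mult.assoc)
  ultimately show ?thesis
    by (metis hull_inc trop_submodule_hull_smult)
qed

text \<open>
  The edges of a path are multiples of shifts of \<open>f\<close>, and eliminating the inner vertices one
  after the other leaves the two ends.
\<close>

lemma pairs_subset_tropical_ideal:
  assumes J: "tropical_ideal J" and f: "f \<in> J"
  shows "pairs \<subseteq> J"
proof -
  have ideal: "is_ideal J"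
    using J by (simp add: tropical_ideal_def homogeneous_ideal_def)
  have edge: "pair (w + u) (w + v) \<in> J" for w
  proof -
    have "single w 1 * f \<in> J"
      using ideal f by (simp add: is_ideal_def)
    then show ?thesis
      using edge_eq[of w] ideal_imp_trop_submodule[OF ideal] by (auto simp: trop_submodule_def)
  qed
  have "reach i j \<Longrightarrow> i = j \<or> pair i j \<in> J" for i j
  proof (induction rule: reach_induct)
    case (step w)
    have apart: "i \<noteq> w + v"
      using step.hyps not_reach_back by blast
    show ?case
    proof (cases "i = w + u")
      case True
      then show ?thesis
        using edge by blast
    next
      case False
      define L where "L = graded_part J (mdegree i)"
      have L: "tropical_linear_space (monomials (mdegree i)) L"
        using J by (simp add: tropical_ideal_def L_def)
      have uv: "w + u \<noteq> w + v"
        using neq by simp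
      have "conn i (w + u)"
        using step.hyps by (simp add: conn_def)
      then have deg_i: "mdegree (w + u) = mdegree i" "mdegree (w + v) = mdegree i"
        using conn_mdegree conn_mdegree[OF conn_edge[of w]] by metis+
      have "pair i (w + u) \<in> L"
        using step.IH False keys_pair[OF False] deg_i
        by (simp add: L_def graded_part_def homogeneous_of_def)
      moreover have "pair (w + u) (w + v) \<in> L"
        using edge keys_pair[OF uv] deg_i by (simp add: L_def graded_part_def homogeneous_of_def)
      ultimately have "pair i (w + v) \<in> L"
        using tropical_linear_space_eliminate[OF L] False uv apart \<phi>_nz unfolding pair_def by blast
      then show ?thesis
        by (simp add: L_def graded_part_def)
    qed
  qed simp
  then show ?thesis
    using pair_commute by (auto simp: pairs_def conn_def) metis
qed

lemma tropically_principal_binomial: "tropically_principal f J \<longleftrightarrow> J = macaulay_ideal f"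
proof (rule tropically_principal_iff_macaulay[OF homogeneous_pairs])
  obtain \<kappa> where "single 0 1 * f = smult \<kappa> (pair (0 + u) (0 + v))"
    using shift_f_eq by blast
  then have "f = smult \<kappa> (pair u v)"
    by simp
  moreover have "pair u v \<in> pairs"
    using neq conn_edge[of 0] by (auto simp: pairs_def)
  ultimately show "f \<in> trop_submodule hull pairs"
    by (metis hull_inc trop_submodule_hull_smult)
qed (assumption | rule macaulay_part_binomial shift_pairs pairs_subset_tropical_ideal)+

section \<open>Lifts of binomials\<close>

lemma swap_reach:
  assumes "path_forest.reach (\<lambda>w. w + v) (\<lambda>w. w + u) i j"
  shows "reach j i"
proof -
  interpret sw: balanced_binomial v u b a \<phi>
    by (rule swap)
  show ?thesis
    using assms by (induction rule: sw.reach_induct) (auto intro: reach_trans[OF reach_edge])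
qed

lemma edge_balance: "a * \<phi> (w + v) = b * \<phi> (w + u)"
  by (simp add: \<phi>_add balance mult.left_commute[of a "\<phi> w"] mult.left_commute[of b "\<phi> w"])

text \<open>
  Follow the path from the edge \<open>w\<close> as long as the contributions of the edges, measured relative to
  \<open>\<phi>\<close>, do not decrease. At the vertex where this stops, the contribution of the last edge dominates
  strictly and the ultrametric inequality is an equality.
\<close>

lemma lift_dominates_edge:
  assumes \<nu>: "nonarch_norm (\<nu> :: 'k::field \<Rightarrow> trop)" and AB: "\<nu> A = a" "\<nu> B = b"
    and G: "G = H * (single u A + single v B)"
  shows "\<exists>j. reach (w + v) j \<and> \<nu> (lookup H w) * a * \<phi> j \<le> \<nu> (lookup G j) * \<phi> (w + u)"
proof -
  \<comment> \<open>A step forward lowers the exponent of \<open>x\<close>, so the walk ends.\<close>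
  obtain x where x: "lookup v x < lookup u x"
    using exists_smaller_exponent[OF deg[symmetric] neq[symmetric]] by blast
  show ?thesis
  proof (induction "lookup w x" arbitrary: w rule: less_induct)
    case less
    let ?c = "\<lambda>w. \<nu> (lookup H w)"
    show ?case
    proof (cases "\<exists>w'. w' + u = w + v \<and> ?c w * b \<le> ?c w' * a")
      case True
      then obtain w' where w': "w' + u = w + v" "?c w * b \<le> ?c w' * a"
        by blast
      have "lookup w' x + lookup u x = lookup w x + lookup v x"
        using w'(1) by (metis lookup_add)
      then have "lookup w' x < lookup w x"
        using x by simp
      from less[OF this] obtain j where j: "reach (w' + v) j"
        "?c w' * a * \<phi> j \<le> \<nu> (lookup G j) * \<phi> (w' + u)"
        by blast
      have "b * (?c w * a * \<phi> j) = ?c w * b * (a * \<phi> j)"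
        by (simp add: mult_ac)
      also have "\<dots> \<le> ?c w' * a * (a * \<phi> j)"
        using w'(2) by (rule mult_right_mono) simp
      also have "\<dots> = a * (?c w' * a * \<phi> j)"
        by (simp add: mult_ac)
      also have "\<dots> \<le> a * (\<nu> (lookup G j) * \<phi> (w' + u))"
        using j(2) by (rule mult_left_mono) simp
      also have "\<dots> = \<nu> (lookup G j) * (a * \<phi> (w + v))"
        by (simp add: w'(1) mult_ac)
      also have "\<dots> = b * (\<nu> (lookup G j) * \<phi> (w + u))"
        by (simp add: edge_balance mult_ac)
      finally have "?c w * a * \<phi> j \<le> \<nu> (lookup G j) * \<phi> (w + u)"
        using mult_le_cancel_trop[OF b] by blast
      moreover have "reach (w + v) j"
        using reach_trans[OF reach_edge[of w'] j(1)] by (simp add: w'(1))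
      ultimately show ?thesis
        by blast
    next
      case False
      have "?c w * a * \<phi> (w + v) \<le> \<nu> (lookup G (w + v)) * \<phi> (w + u)"
      proof (cases "lookup H w = 0")
        case True
        then show ?thesis
          using nonarch_norm_eq_0_iff[OF \<nu>, of 0] by simp
      next
        case nonzero: False
        let ?y = "lookup (H * single u A) (w + v)"
        have "\<nu> ?y < \<nu> (lookup H w * B)"
        proof (cases "\<exists>w'. w + v = w' + u")
          case True
          then obtain w' where w': "w + v = w' + u"
            by blast
          then show ?thesis
            using False by (auto simp: lookup_mult_single_add nonarch_norm_mult[OF \<nu>] AB not_le)
        next
          case no_edge: False
          have "?y = 0"
            by (rule lookup_mult_single_eq_0) (use no_edge in blast)
          moreover have "0 < \<nu> (lookup H w * B)"
            using nonzero b nonarch_norm_eq_0_iff[OF \<nu>]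
            by (simp add: nonarch_norm_mult[OF \<nu>] AB zero_less_iff_neq_zero)
          ultimately show ?thesis
            using nonarch_norm_eq_0_iff[OF \<nu>, of 0] by simp
        qed
        then have "\<nu> (lookup H w * B + ?y) = ?c w * b"
          using nonarch_norm_add_dominant[OF \<nu>, of ?y "lookup H w * B"]
          by (simp add: nonarch_norm_mult[OF \<nu>] AB)
        moreover have "lookup G (w + v) = lookup H w * B + ?y"
          by (simp add: G distrib_left lookup_add lookup_mult_single_add)
        ultimately have "\<nu> (lookup G (w + v)) = ?c w * b"
          by simp
        then show ?thesis
          by (simp add: mult.assoc edge_balance)
      qed
      then show ?thesis
        using reach_refl by blast
    qed
  qed
qed

text \<open>
  The entry at \<open>m\<close> is a sum of the contributions of the edges that start and end there. One of them
  is at least as large as the sum, and the walk begins with that edge, away from \<open>m\<close>.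
\<close>

lemma lift_dominates_vertex:
  assumes \<nu>: "nonarch_norm (\<nu> :: 'k::field \<Rightarrow> trop)" and AB: "\<nu> A = a" "\<nu> B = b"
    and G: "G = H * (single u A + single v B)" and m: "lookup G m \<noteq> 0"
  shows "\<exists>j. j \<noteq> m \<and> conn m j \<and> \<nu> (lookup G m) * \<phi> j \<le> \<nu> (lookup G j) * \<phi> m"
proof -
  interpret sw: balanced_binomial v u b a \<phi>
    by (rule swap)
  let ?y = "lookup (H * single u A) m" and ?z = "lookup (H * single v B) m"
  have "lookup G m = ?y + ?z"
    by (simp add: G distrib_left lookup_add)
  then have le: "\<nu> (lookup G m) \<le> \<nu> ?y \<or> \<nu> (lookup G m) \<le> \<nu> ?z"
    using nonarch_norm_add[OF \<nu>, of ?y ?z] by (auto simp: le_max_iff_disj)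
  have pos: "\<nu> (lookup G m) \<noteq> 0" and \<nu>0: "\<nu> 0 = 0"
    using m nonarch_norm_eq_0_iff[OF \<nu>] by auto
  from le show ?thesis
  proof
    assume y: "\<nu> (lookup G m) \<le> \<nu> ?y"
    then have "?y \<noteq> 0"
      using pos \<nu>0 by auto
    then obtain w where w: "m = w + u"
      using lookup_mult_single_eq_0 by blast
    obtain j where j: "reach (w + v) j"
      "\<nu> (lookup H w) * a * \<phi> j \<le> \<nu> (lookup G j) * \<phi> (w + u)"
      using lift_dominates_edge[OF \<nu> AB G] by blast
    have "\<nu> (lookup G m) * \<phi> j \<le> \<nu> (lookup H w) * a * \<phi> j"
      using y by (intro mult_right_mono) (auto simp: w lookup_mult_single_add nonarch_norm_mult[OF \<nu>] AB)
    then have "\<nu> (lookup G m) * \<phi> j \<le> \<nu> (lookup G j) * \<phi> m"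
      using j(2) w by simp
    moreover have "conn m j"
      using reach_trans[OF reach_edge j(1)] by (simp add: conn_def w)
    moreover have "j \<noteq> m"
      using j(1) not_reach_back w by blast
    ultimately show ?thesis
      by blast
  next
    assume z: "\<nu> (lookup G m) \<le> \<nu> ?z"
    then have "?z \<noteq> 0"
      using pos \<nu>0 by auto
    then obtain w where w: "m = w + v"
      using lookup_mult_single_eq_0 by blast
    have "G = H * (single v B + single u A)"
      by (simp add: G add.commute)
    then obtain j where j: "sw.reach (w + u) j"
      "\<nu> (lookup H w) * b * \<phi> j \<le> \<nu> (lookup G j) * \<phi> (w + v)"
      using sw.lift_dominates_edge[OF \<nu> AB(2,1)] by blast
    have "\<nu> (lookup G m) * \<phi> j \<le> \<nu> (lookup H w) * b * \<phi> j"
      using z by (intro mult_right_mono) (auto simp: w lookup_mult_single_add nonarch_norm_mult[OF \<nu>] AB)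
    then have "\<nu> (lookup G m) * \<phi> j \<le> \<nu> (lookup G j) * \<phi> m"
      using j(2) w by simp
    moreover have "conn m j"
      using reach_trans[OF swap_reach[OF j(1)] reach_edge] by (simp add: conn_def w)
    moreover have "j \<noteq> m"
      using swap_reach[OF j(1)] not_reach_back w by blast
    ultimately show ?thesis
      by blast
  qed
qed

text \<open>
  If no entry strictly dominates its component, relative to \<open>\<phi>\<close>, each entry is attained by a
  multiple of a pair that lies below the vector, and the sum of these multiples is the vector.
\<close>

lemma in_hull_pairs:
  assumes dom: "\<And>m. m \<in> keys g \<Longrightarrow> \<exists>j. j \<noteq> m \<and> conn m j \<and> lookup g m * \<phi> j \<le> lookup g j * \<phi> m"
  shows "g \<in> trop_submodule hull pairs"
proof -
  obtain j where j: "\<And>m. m \<in> keys g \<Longrightarrow> j m \<noteq> m" "\<And>m. m \<in> keys g \<Longrightarrow> conn m (j m)"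
    and le: "\<And>m. m \<in> keys g \<Longrightarrow> lookup g m * \<phi> (j m) \<le> lookup g (j m) * \<phi> m"
    using dom by metis
  have "\<exists>c. c * \<phi> m = lookup g m" for m
    using trop_inverse[OF \<phi>_nz, of m] by (metis mult.assoc mult_1_right)
  then obtain c where c: "\<And>m. c m * \<phi> m = lookup g m"
    by metis
  let ?z = "\<lambda>m. smult (c m) (pair m (j m))"
  have z_le: "lookup (?z m) k \<le> lookup g k" if m: "m \<in> keys g" for m k
  proof -
    have "\<phi> m * (c m * \<phi> (j m)) = lookup g m * \<phi> (j m)"
      by (simp add: mult_ac flip: c)
    also have "\<dots> \<le> \<phi> m * lookup g (j m)"
      using le[OF m] by (simp add: mult.commute)
    finally have "c m * \<phi> (j m) \<le> lookup g (j m)"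
      using mult_le_cancel_trop[OF \<phi>_nz] by blast
    then show ?thesis
      using c[of m] j(1)[OF m] by (simp add: lookup_pair[OF j(1)[OF m, symmetric]])
  qed
  have "(\<Sum>m\<in>keys g. ?z m) = g"
  proof (rule poly_mapping_eqI)
    fix k
    have "(\<Sum>m\<in>keys g. lookup (?z m) k) \<le> lookup g k"
      by (rule sum_trop_leI) (rule z_le)
    moreover have "lookup g k \<le> (\<Sum>m\<in>keys g. lookup (?z m) k)"
    proof (cases "k \<in> keys g")
      case True
      then have "lookup (?z k) k = lookup g k"
        using c[of k] by (simp add: lookup_pair[OF j(1)[OF True, symmetric]])
      then show ?thesis
        using member_le_sum_trop[of "keys g" k "\<lambda>m. lookup (?z m) k"] True by simp
    qed (simp add: in_keys_iff)
    ultimately show "lookup (\<Sum>m\<in>keys g. ?z m) k = lookup g k"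
      unfolding lookup_sum by (rule order.antisym)
  qed
  moreover have "(\<Sum>m\<in>keys g. ?z m) \<in> trop_submodule hull pairs"
  proof (intro trop_submodule_sum trop_submodule_hull trop_submodule_hull_smult hull_inc)
    fix m assume "m \<in> keys g"
    then have "m \<noteq> j m" "conn m (j m)"
      using j[of m] by auto
    then show "pair m (j m) \<in> pairs"
      unfolding pairs_def by blast
  qed
  ultimately show ?thesis
    by simp
qed

text \<open>
  The two-term combinations that cancel the inner vertices of a path. The coefficients need not
  have the norms \<open>\<phi> i\<close> and \<open>\<phi> j\<close>, which may lie outside the image of \<open>\<nu>\<close>; only the ratio of
  their norms is prescribed.
\<close>

lemma reach_imp_lifted_pair:
  assumes \<nu>: "nonarch_norm (\<nu> :: 'k::field \<Rightarrow> trop)" and AB: "\<nu> A = a" "\<nu> B = b"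
    and I: "is_ideal I" "single u A + single v B \<in> I"
    and "reach i j"
  shows "i = j \<or> (\<exists>C D. C \<noteq> 0 \<and> single i C + single j D \<in> I \<and> \<nu> C * \<phi> j = \<nu> D * \<phi> i)"
  using \<open>reach i j\<close>
proof (induction rule: reach_induct)
  case (step w)
  let ?edge = "single w 1 * (single u A + single v B)"
  have edge: "?edge \<in> I" "?edge = single (w + u) A + single (w + v) B"
    using I by (auto simp only: is_ideal_def) (simp add: distrib_left mult_single)
  have nz: "A \<noteq> 0"
    using AB a nonarch_norm_eq_0_iff[OF \<nu>] by metis
  show ?case
  proof (cases "i = w + u")
    case True
    then show ?thesis
      using edge nz AB edge_balance by auto
  next
    case False
    with step.IH obtain C D where CD: "C \<noteq> 0" "single i C + single (w + u) D \<in> I"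
      "\<nu> C * \<phi> (w + u) = \<nu> D * \<phi> i"
      by blast
    have "single 0 A * (single i C + single (w + u) D) + single 0 (- D) * ?edge \<in> I"
      using I(1) CD(2) edge(1) unfolding is_ideal_def by blast
    also have "single 0 A * (single i C + single (w + u) D) + single 0 (- D) * ?edge
        = single i (A * C) + (single (w + u) (A * D) + single (w + u) (- D * A))
          + single (w + v) (- D * B)"
      by (simp only: edge(2) distrib_left mult_single add_0_left mult_1 add.assoc)
    also have "single (w + u) (A * D) + single (w + u) (- D * A) = 0"
      by (simp add: mult.commute flip: single_add)
    finally have "single i (A * C) + single (w + v) (- D * B) \<in> I"
      by simp
    moreover have "\<nu> (A * C) * \<phi> (w + v) = \<nu> (- D * B) * \<phi> i"
    proof -
      have "\<nu> (A * C) * \<phi> (w + v) = \<nu> C * (a * \<phi> (w + v))"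
        by (simp add: nonarch_norm_mult[OF \<nu>] AB mult_ac)
      also have "\<dots> = b * (\<nu> C * \<phi> (w + u))"
        by (simp add: edge_balance mult_ac)
      also have "\<dots> = \<nu> (- D * B) * \<phi> i"
        by (simp add: CD(3) nonarch_norm_minus[OF \<nu>] nonarch_norm_mult[OF \<nu>] AB mult_ac)
      finally show ?thesis .
    qed
    ultimately show ?thesis
      using nz CD(1) by (intro disjI2 exI[of _ "A * C"] exI[of _ "- D * B"]) simp
  qed
qed simp

lemma lift_pair:
  assumes \<nu>: "nonarch_norm (\<nu> :: 'k::field \<Rightarrow> trop)" and AB: "\<nu> A = a" "\<nu> B = b"
    and I: "is_ideal I" "single u A + single v B \<in> I"
    and ij: "reach i j" "i \<noteq> j"
  shows "\<exists>G\<in>I. keys G \<subseteq> keys (pair i j) \<and> (\<exists>c. pair i j = smult c (trop_poly \<nu> G))"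
proof -
  obtain C D where CD: "C \<noteq> 0" "single i C + single j D \<in> I" "\<nu> C * \<phi> j = \<nu> D * \<phi> i"
    using reach_imp_lifted_pair[OF \<nu> AB I ij(1)] ij(2) by blast
  have "\<nu> C \<noteq> 0"
    using CD(1) nonarch_norm_eq_0_iff[OF \<nu>] by simp
  then obtain d where d: "d * \<nu> C = 1"
    using trop_inverse by blast
  have "d * \<phi> i * \<nu> C = \<phi> i * (d * \<nu> C)"
    by (simp add: mult_ac)
  then have i: "d * \<phi> i * \<nu> C = \<phi> i"
    by (simp add: d)
  have "d * \<phi> i * \<nu> D = d * (\<nu> C * \<phi> j)"
    by (simp add: CD(3) mult_ac)
  then have j: "d * \<phi> i * \<nu> D = \<phi> j"
    by (simp add: d flip: mult.assoc)
  have "pair i j = smult (d * \<phi> i) (trop_poly \<nu> (single i C + single j D))"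
  proof (rule poly_mapping_eqI)
    fix m
    show "lookup (pair i j) m = lookup (smult (d * \<phi> i) (trop_poly \<nu> (single i C + single j D))) m"
      using i j ij(2) nonarch_norm_eq_0_iff[OF \<nu>, of 0]
      by (simp add: lookup_pair lookup_trop_poly[OF \<nu>] lookup_add lookup_single when_def)
  qed
  moreover have "keys (single i C + single j D) \<subseteq> keys (pair i j)"
    using keys_add[of "single i C" "single j D"] keys_pair[OF ij(2)] by (auto split: if_splits)
  ultimately show ?thesis
    using CD(2) by blast
qed

lemma macaulay_ideal_binomial_realizable:
  assumes \<nu>: "nonarch_norm (\<nu> :: 'k::field \<Rightarrow> trop)" and AB: "\<nu> A = a" "\<nu> B = b"
  shows "macaulay_ideal f = trop_ideal \<nu> (is_ideal hull {single u A + single v B})"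
    (is "_ = trop_ideal \<nu> ?I")
proof (rule macaulay_ideal_eq_trop_ideal[OF homogeneous_pairs])
  fix g assume "g \<in> pairs"
  then obtain i j where ij: "g = pair i j" "i \<noteq> j" "conn i j"
    by (auto simp: pairs_def)
  have I: "is_ideal ?I" "single u A + single v B \<in> ?I"
    by (rule hull_in) (auto simp: is_ideal_def intro: hull_inc)
  show "\<exists>G\<in>?I. keys G \<subseteq> keys g \<and> (\<exists>c. g = smult c (trop_poly \<nu> G))"
    using ij lift_pair[OF \<nu> AB I, of i j] lift_pair[OF \<nu> AB I, of j i] pair_commute
    by (auto simp: conn_def)
next
  fix G assume "G \<in> ?I"
  then obtain H where "G = H * (single u A + single v B)"
    by (auto simp: is_ideal_hull_singleton)
  then show "trop_poly \<nu> G \<in> trop_submodule hull pairs"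
    using lift_dominates_vertex[OF \<nu> AB]
    by (intro in_hull_pairs) (auto simp: keys_trop_poly[OF \<nu>] lookup_trop_poly[OF \<nu>] in_keys_iff)
qed (assumption | rule macaulay_part_binomial)+

end

lemma poly_mapping_eq_two_singles:
  assumes "keys f \<subseteq> {u, v}" "u \<noteq> v"
  shows "f = single u (lookup f u) + single v (lookup f v)"
  by (rule poly_mapping_eqI)
    (use assms in \<open>auto simp: lookup_add lookup_single when_def in_keys_iff\<close>)

lemma poly_mapping_eq_single:
  assumes "keys f \<subseteq> {u}"
  shows "f = single u (lookup f u)"
  by (rule poly_mapping_eqI) (use assms in \<open>auto simp: lookup_single when_def in_keys_iff\<close>)

theorem theorem2:
  fixes f :: "('v::finite, trop) polynomial"
  assumes "homogeneous f"
    and "card (Poly_Mapping.keys f) = 1 \<or> card (Poly_Mapping.keys f) = 2"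
  shows "(\<forall>J. tropically_principal f J \<longleftrightarrow> J = macaulay_ideal f) \<and>
    (\<forall>(\<nu> :: 'k::field \<Rightarrow> trop) (F :: ('v, 'k) polynomial).
      nonarch_norm \<nu> \<and> trop_poly \<nu> F = f \<longrightarrow>
      macaulay_ideal f = trop_ideal \<nu> (is_ideal hull {F}))"
  using assms(2)
proof
  assume "card (Poly_Mapping.keys f) = 1"
  then obtain u where keys: "keys f = {u}"
    by (auto simp: card_1_singleton_iff)
  define a where "a = lookup f u"
  have f: "f = single u a"
    unfolding a_def by (rule poly_mapping_eq_single) (simp add: keys)
  have a: "a \<noteq> 0"
    using keys by (auto simp: a_def in_keys_iff)
  have "macaulay_ideal f = trop_ideal \<nu> (is_ideal hull {F})"
    if \<nu>: "nonarch_norm \<nu>" and F: "trop_poly \<nu> F = f" for \<nu> :: "'k \<Rightarrow> trop" and F :: "('v, 'k) polynomial"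
  proof -
    have "F = single u (lookup F u)"
      by (rule poly_mapping_eq_single) (use keys keys_trop_poly[OF \<nu>, of F] F in simp)
    moreover have "\<nu> (lookup F u) = a"
      using lookup_trop_poly[OF \<nu>, of F u] by (simp add: F a_def)
    ultimately show ?thesis
      using macaulay_ideal_monomial_realizable[OF a \<nu>] f by metis
  qed
  then show ?thesis
    using tropically_principal_monomial[OF a] f by blast
next
  assume "card (Poly_Mapping.keys f) = 2"
  then obtain u v where keys: "keys f = {u, v}" and neq: "u \<noteq> v"
    by (auto simp: card_2_iff)
  define a b where "a = lookup f u" and "b = lookup f v"
  have f: "f = single u a + single v b"
    unfolding a_def b_def by (rule poly_mapping_eq_two_singles) (simp_all add: keys neq)
  have ab: "a \<noteq> 0" "b \<noteq> 0"
    using keys by (auto simp: a_def b_def in_keys_iff)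
  have deg: "mdegree u = mdegree v"
    using assms(1) keys by (auto simp: homogeneous_def homogeneous_of_def)
  obtain \<phi> where "\<And>m. \<phi> m \<noteq> 0" "\<And>m n. \<phi> (m + n) = \<phi> m * \<phi> n" "a * \<phi> v = b * \<phi> u"
    using balancing_potential[OF deg neq ab] by blast
  then interpret balanced_binomial u v a b \<phi>
    using deg neq ab by unfold_locales
  have "macaulay_ideal f = trop_ideal \<nu> (is_ideal hull {F})"
    if \<nu>: "nonarch_norm \<nu>" and F: "trop_poly \<nu> F = f" for \<nu> :: "'k \<Rightarrow> trop" and F :: "('v, 'k) polynomial"
  proof -
    have "F = single u (lookup F u) + single v (lookup F v)"
      by (rule poly_mapping_eq_two_singles) (use keys keys_trop_poly[OF \<nu>, of F] F neq in simp_all)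
    moreover have "\<nu> (lookup F u) = a" "\<nu> (lookup F v) = b"
      using lookup_trop_poly[OF \<nu>, of F] by (simp_all add: F a_def b_def)
    ultimately show ?thesis
      using macaulay_ideal_binomial_realizable[OF \<nu>] unfolding f by metis
  qed
  then show ?thesis
    using tropically_principal_binomial unfolding f by blast
qed

end
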